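(* Consider the symmetric facilitated exclusion process on the circle $\mathbb{T}_N$ with $k$ particles, and let $T_{\mathcal{G}_{N,k}}(\epsilon)$ be the $\epsilon$-mixing time of the process started from its ergodic component $\mathcal{G}_{N,k}$. Let $k=k(N)>N/2$ be a sequence of integers such that $k(N)/N\to\rho\in(1/2,1)$ as $N\to\infty$. Then for every $\epsilon\in(0,1)$ there exists a constant $C(\epsilon)>0$ such that $$ T_{\mathcal{G}_{N,k}}(\epsilon)\leq C(\epsilon)\,N^{2}\log N $$ for all $N$ sufficiently large.
   Context: Symmetric facilitated exclusion process (SFEP) on the circle. Let $\mathbb{T}_N=\mathbb{Z}/N\mathbb{Z}$ and $\Omega^\circ_{N,k}=\{\xi\in\{0,1\}^{\mathbb{T}_N}:\sum_{x\in\mathbb{T}_N}\xi(x)=k\}$; $\xi(x)=1$ means a particle at $x$, $\xi(x)=0$ a hole. The SFEP is the continuous-time Markov chain on $\Omega^\circ_{N,k}$ with generator $$\mathcal{L}^\circ f(\xi)=\sum_{x\in\mathbb{T}_N}\tfrac12\xi(x)\xi(x-1)(1-\xi(x+1))[f(\xi^{x,x+1})-f(\xi)]+\sum_{x\in\mathbb{T}_N}\tfrac12\xi(x)\xi(x+1)(1-\xi(x-1))[f(\xi^{x,x-1})-f(\xi)],$$ where $\xi^{x,y}$ is obtained from $\xi$ by exchanging the values at $x$ and $y$. $P_t^\xi$ denotes the law at time $t$ of the SFEP started from $\xi$. The ergodic component is $\mathcal{G}_{N,k}=\{\xi\in\Omega^\circ_{N,k}:\xi(x)+\xi(x+1)\ge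 1\ \forall x\in\mathbb{T}_N\}$, and $\nu_{N,k}$ is the uniform distribution on $\mathcal{G}_{N,k}$. The mixing time restricted to the ergodic component is $$T_{\mathcal{G}_{N,k}}(\epsilon)=\inf\Bigl\{t\ge0:\max_{\xi\in\mathcal{G}_{N,k}}\|P_t^\xi-\nu_{N,k}\|_{\mathrm{TV}}\le\epsilon\Bigr\}.$$ *)

theory Defs
  imports "HOL-Probability.Probability"
begin

text \<open>
  The discrete circle Z/NZ, with canonical representatives; neighbours are taken mod N.
\<close>

definition circle :: "nat \<Rightarrow> int set" where
  "circle N = {0..<int N}"

definition right_of :: "nat \<Rightarrow> int \<Rightarrow> int" where
  "right_of N x = (x + 1) mod int N"

definition left_of :: "nat \<Rightarrow> int \<Rightarrow> int" where
  "left_of N x = (x - 1) mod int N"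

type_synonym config = "int \<Rightarrow> nat"

definition configs :: "nat \<Rightarrow> nat \<Rightarrow> config set" where
  "configs N k = {\<xi> \<in> circle N \<rightarrow>\<^sub>E {0, 1}. (\<Sum>x\<in>circle N. \<xi> x) = k}"

definition exchange :: "config \<Rightarrow> int \<Rightarrow> int \<Rightarrow> config" where
  "exchange \<xi> x y = \<xi>(x := \<xi> y, y := \<xi> x)"

definition sfep_generator :: "nat \<Rightarrow> (config \<Rightarrow> real) \<Rightarrow> config \<Rightarrow> real" where
  "sfep_generator N f \<xi> =
     (\<Sum>x\<in>circle N. 1/2 * real (\<xi> x) * real (\<xi> (left_of N x)) * (1 - real (\<xi> (right_of N x)))
        * (f (exchange \<xi> x (right_of N x)) - f \<xi>))
   + (\<Sum>x\<in>circle N. 1/2 * real (\<xi> x) * real (\<xi> (right_of N x)) * (1 - real (\<xi> (left_of N x)))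
        * (f (exchange \<xi> x (left_of N x)) - f \<xi>))"

text \<open>
  The Markov semigroup \<open>exp (t L)\<close> of the generator \<open>L\<close>, as a power series. At \<open>\<xi> \<in> configs N k\<close>
  the generator only involves values of \<open>f\<close> on the finite set \<open>configs N k\<close>, on which it is bounded,
  so the series converges there.
\<close>

definition sfep_semigroup :: "nat \<Rightarrow> real \<Rightarrow> (config \<Rightarrow> real) \<Rightarrow> config \<Rightarrow> real" where
  "sfep_semigroup N t f \<xi> = (\<Sum>n. t ^ n / fact n * (sfep_generator N ^^ n) f \<xi>)"

text \<open>The law at time \<open>t\<close> of the process started from \<open>\<xi>\<close>, as a function of events.\<close>

definition sfep_law :: "nat \<Rightarrow> real \<Rightarrow> config \<Rightarrow> config set \<Rightarrow> real" where
  "sfep_law N t \<xi> A = sfep_semigroup N t (indicator A) \<xi>"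

definition ergodic_component :: "nat \<Rightarrow> nat \<Rightarrow> config set" where
  "ergodic_component N k =
     {\<xi> \<in> configs N k. \<forall>x\<in>circle N. \<xi> x + \<xi> (right_of N x) \<ge> 1}"

definition ergodic_uniform :: "nat \<Rightarrow> nat \<Rightarrow> config set \<Rightarrow> real" where
  "ergodic_uniform N k A = measure_pmf.prob (pmf_of_set (ergodic_component N k)) A"

definition tv_dist :: "'a set \<Rightarrow> ('a set \<Rightarrow> real) \<Rightarrow> ('a set \<Rightarrow> real) \<Rightarrow> real" where
  "tv_dist \<Omega> \<mu> \<nu> = (SUP A\<in>Pow \<Omega>. \<bar>\<mu> A - \<nu> A\<bar>)"

text \<open>
  Extended real valued, so that the infimum over an empty set of times is \<open>\<infinity>\<close>.
\<close>

definition ergodic_mixing_time :: "nat \<Rightarrow> nat \<Rightarrow> real \<Rightarrow> ereal" where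
  "ergodic_mixing_time N k \<epsilon> =
     Inf (ereal ` {t. t \<ge> 0 \<and>
       (MAX \<xi>\<in>ergodic_component N k.
          tv_dist (configs N k) (sfep_law N t \<xi>) (ergodic_uniform N k)) \<le> \<epsilon>})"

end

theory Submission
  imports Defs
begin

text \<open>
  On the ergodic component the holes are isolated, so a configuration is described by the positions
  of its labelled particles, a quasi-periodic integer sequence with gaps 1 or 2, and the dynamics
  flips local corners of this sequence. Couple two sequences that differ by 1 exactly on a periodic
  arc of \<open>d\<close> labels, using the same flips for both, except that at \<open>d = 1\<close> and \<open>d = k - 1\<close> the
  single label inside, respectively outside, the arc flips in one copy at a time: \<open>d\<close> performs a
  simple random walk, absorbed when \<open>d = 0\<close>. At \<open>d = k\<close> the two configurations are translates of each other by one site, and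
  they are also joined by moving each of the \<open>N - k\<close> holes by one step, that is by \<open>N - k\<close> pairs
  with \<open>d = 1\<close>. For \<open>\<rho> > 1/2\<close> the ratio \<open>(N - k) / k\<close> stays below 1, and the weight
  \<open>sin (a d / k)\<close>, with \<open>a\<close> small, is then at least \<open>N - k\<close> times larger at \<open>d = k\<close> than at \<open>d = 1\<close>.
  Hence the Lipschitz seminorm for this weight is contracted by the semigroup at a rate of order
  \<open>1 / N\<^sup>2\<close>. Any two configurations are joined by at most \<open>2 N k\<close> pairs with \<open>d = 1\<close>, so times of
  order \<open>N\<^sup>2 log N\<close> suffice.
\<close>

section \<open>Labelled particles on the unrolled circle\<close>

definition labelings :: "nat \<Rightarrow> nat \<Rightarrow> (int \<Rightarrow> int) set" where
  "labelings N k = {x. (\<forall>i. x (i + int k) = x i + int N) \<and> (\<forall>i. x (i + 1) - x i \<in> {1, 2})}"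

definition occupation :: "nat \<Rightarrow> (int \<Rightarrow> int) \<Rightarrow> config" where
  "occupation N x = (\<lambda>y\<in>circle N. if y \<in> range x then 1 else 0)"

text \<open>
  Gaps \<open>(1, 2)\<close> and \<open>(2, 1)\<close> around label \<open>i\<close> are interchanged, which is a particle jump; equal
  gaps are left alone. Written this way the flip is linear in \<open>x\<close>.
\<close>

definition corner_flip :: "nat \<Rightarrow> int \<Rightarrow> (int \<Rightarrow> int) \<Rightarrow> int \<Rightarrow> int" where
  "corner_flip k i x = (\<lambda>j. if (j - i) mod int k = 0 then x (j - 1) + x (j + 1) - x j else x j)"

text \<open>Difference profile of a coupled pair. Lengths 0 and \<open>k\<close> give the constants
  0 and 1, so coalescence and translation by one site stay distinct.\<close>

definition label_arc :: "nat \<Rightarrow> int \<Rightarrow> int \<Rightarrow> int \<Rightarrow> int" where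
  "label_arc k j d = (\<lambda>i. if (i - j) mod int k < d then 1 else 0)"

lemma labelings_gap:
  assumes "x \<in> labelings N k"
  shows "x (i + 1) - x i = 1 \<or> x (i + 1) - x i = 2"
  using assms by (auto simp: labelings_def)

lemma labelings_gap_left:
  assumes "x \<in> labelings N k"
  shows "x i - x (i - 1) = 1 \<or> x i - x (i - 1) = 2"
  using labelings_gap[OF assms, of "i - 1"] by simp

lemma labelings_period:
  assumes "x \<in> labelings N k"
  shows "x (i + int k) = x i + int N"
  using assms by (auto simp: labelings_def)

lemma labelings_period_mult:
  assumes "x \<in> labelings N k"
  shows "x (i + q * int k) = x i + q * int N"
proof (induction q rule: int_induct[where k = 0])
  case base
  show ?case by simp
next
  case (step1 q)
  have "x (i + q * int k + int k) = x (i + q * int k) + int N"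
    using labelings_period[OF assms] .
  then show ?case using step1 by (simp add: algebra_simps)
next
  case (step2 q)
  have "x ((i + (q - 1) * int k) + int k) = x (i + (q - 1) * int k) + int N"
    using labelings_period[OF assms] .
  then show ?case using step2 by (simp add: algebra_simps)
qed

lemma strict_mono_intI:
  fixes x :: "int \<Rightarrow> int"
  assumes "\<And>i. x i < x (i + 1)"
  shows "strict_mono x"
proof -
  have *: "x i < x (i + int (Suc n))" for i n
  proof (induction n)
    case 0
    then show ?case using assms[of i] by simp
  next
    case (Suc n)
    then show ?case using assms[of "i + int (Suc n)"] by (simp add: algebra_simps)
  qed
  show ?thesis
  proof (rule strict_monoI)
    fix i j :: int assume "i < j"
    then have "j = i + int (Suc (nat (j - i) - 1))" by simp
    then show "x i < x j" using * by metis
  qed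
qed

lemma labelings_strict_mono:
  assumes "x \<in> labelings N k"
  shows "strict_mono x"
proof (rule strict_mono_intI)
  show "x i < x (i + 1)" for i using labelings_gap[OF assms, of i] by auto
qed

lemma mem_range_labeling_mod:
  assumes "x \<in> labelings N k"
  shows "z mod int N \<in> range x \<longleftrightarrow> z \<in> range x"
proof -
  have *: "z + q * int N \<in> range x" if "z \<in> range x" for z q
    using that labelings_period_mult[OF assms] by (metis rangeE rangeI)
  have "z = z mod int N + (z div int N) * int N" by simp
  moreover have "z mod int N = z + (- (z div int N)) * int N"
    by (simp add: minus_div_mult_eq_mod[symmetric])
  ultimately show ?thesis using * by metis
qed

lemma succ_mem_range_labeling:
  assumes "x \<in> labelings N k"
  shows "x i + 1 \<in> range x \<longleftrightarrow> x (i + 1) - x i = 1"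
proof
  assume "x i + 1 \<in> range x"
  then obtain m where m: "x m = x i + 1" by auto
  then have "i < m" using strict_mono_less[OF labelings_strict_mono[OF assms], of i m] by simp
  then have "x (i + 1) \<le> x m"
    using strict_mono_less_eq[OF labelings_strict_mono[OF assms], of "i + 1" m] by simp
  then show "x (i + 1) - x i = 1" using m labelings_gap[OF assms, of i] by auto
next
  assume "x (i + 1) - x i = 1"
  then have "x i + 1 = x (i + 1)" by simp
  then show "x i + 1 \<in> range x" by simp
qed

lemma pred_mem_range_labeling:
  assumes "x \<in> labelings N k"
  shows "x i - 1 \<in> range x \<longleftrightarrow> x i - x (i - 1) = 1"
proof
  assume "x i - 1 \<in> range x"
  then obtain m where m: "x m = x i - 1" by auto
  then have "m < i" using strict_mono_less[OF labelings_strict_mono[OF assms], of m i] by simp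
  then have "x m \<le> x (i - 1)"
    using strict_mono_less_eq[OF labelings_strict_mono[OF assms], of m "i - 1"] by simp
  then show "x i - x (i - 1) = 1" using m labelings_gap_left[OF assms, of i] by auto
next
  assume "x i - x (i - 1) = 1"
  then have "x i - 1 = x (i - 1)" by simp
  then show "x i - 1 \<in> range x" by simp
qed

lemma occupation_mod:
  assumes "x \<in> labelings N k" "N > 0"
  shows "occupation N x (z mod int N) = (if z \<in> range x then 1 else 0)"
  using assms mem_range_labeling_mod[OF assms(1), of z]
  by (auto simp: occupation_def circle_def)

section \<open>Modular arithmetic and auxiliary identities\<close>

lemma mod_add_one_int:
  fixes m k :: int
  assumes "k > 0"
  shows "(m + 1) mod k = (if m mod k = k - 1 then 0 else m mod k + 1)"
proof -
  have *: "(m + 1) mod k = (m mod k + 1) mod k" by (simp add: mod_simps)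
  show ?thesis
  proof (cases "m mod k = k - 1")
    case True then show ?thesis using * by simp
  next
    case False
    have "m mod k < k" "m mod k \<ge> 0" using assms by auto
    then have "(m mod k + 1) mod k = m mod k + 1" using False by (intro mod_pos_pos_trivial) auto
    then show ?thesis using * False by simp
  qed
qed

lemma mod_diff_one_int:
  fixes m k :: int
  assumes "k > 0"
  shows "(m - 1) mod k = (if m mod k = 0 then k - 1 else m mod k - 1)"
proof -
  have "(m - 1) mod k < k" "(m - 1) mod k \<ge> 0" using assms by auto
  then show ?thesis using mod_add_one_int[OF assms, of "m - 1"] by (auto split: if_splits)
qed

text \<open>Compares two fair coin updates by matching their outcomes in pairs. Exchanging the
  summands of one average gives the coupling with opposite coins.\<close>

lemma abs_diff_average_le:
  fixes a b c d e w :: real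
  assumes "\<bar>a - c\<bar> \<le> w" "\<bar>b - d\<bar> \<le> e"
  shows "\<bar>(a + b) / 2 - (c + d) / 2\<bar> \<le> (w + e) / 2"
  using assms unfolding abs_le_iff by (simp add: field_simps)

lemma diff_mod_eq_0_iff:
  fixes m i k :: int
  shows "(m - i) mod k = 0 \<longleftrightarrow> m mod k = i mod k"
  by (metis dvd_eq_mod_eq_0 mod_eq_dvd_iff)

lemma diff_mod_eq_0E:
  fixes m i k :: int
  assumes "(m - i) mod k = 0"
  obtains q where "m = i + q * k"
  using assms by (metis add.commute diff_add_cancel dvd_def mod_0_imp_dvd mult.commute)

text \<open>Binomial theorem for powers of \<open>c\<close> times (shift minus identity) in
  \<open>j\<close>, by Pascal's rule. The exponent \<open>n + i\<close> has the parity of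
  \<open>n - i\<close> and avoids truncated subtraction.\<close>

lemma iterated_difference_binomial:
  fixes u :: "nat \<Rightarrow> nat \<Rightarrow> real"
  assumes "\<And>n j. u (Suc n) j = c * (u n (Suc j) - u n j)"
  shows "u n j = c ^ n * (\<Sum>i\<le>n. real (n choose i) * (-1) ^ (n + i) * u 0 (j + i))"
proof (induction n arbitrary: j)
  case 0
  show ?case by simp
next
  case (Suc n)
  let ?t = "\<lambda>i. (-1) ^ (n + i) * u 0 (j + i)"
  have "(\<Sum>i\<le>Suc n. real (Suc n choose i) * (-1) ^ (Suc n + i) * u 0 (j + i))
    = - ?t 0 + (\<Sum>i\<le>n. real (Suc n choose Suc i) * (- ?t (Suc i)))"
    by (subst sum.atMost_Suc_shift) (simp add: mult.assoc)
  also have "\<dots> = - ?t 0 + (\<Sum>i\<le>n. real (n choose i) * (- ?t (Suc i)))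
      + (\<Sum>i\<le>n. real (n choose Suc i) * (- ?t (Suc i)))"
    by (simp add: sum.distrib[symmetric] algebra_simps)
  also have "\<dots> = (\<Sum>i\<le>n. real (n choose i) * (- ?t (Suc i))) + (\<Sum>i\<le>Suc n. real (n choose i) * (- ?t i))"
    unfolding sum.atMost_Suc_shift[of "\<lambda>i. real (n choose i) * (- ?t i)" n]
    by (simp only: binomial_n_0 of_nat_1 mult_1 add_ac)
  also have "\<dots> = (\<Sum>i\<le>n. real (n choose i) * (-1) ^ (n + i) * u 0 (Suc j + i))
      - (\<Sum>i\<le>n. real (n choose i) * (-1) ^ (n + i) * u 0 (j + i))"
    by (simp add: sum_negf mult_ac)
  finally show ?case unfolding assms Suc by (simp only: power_Suc right_diff_distrib mult.assoc)
qed

text \<open>With \<open>k\<close> at least 4, a label and its neighbours stay distinct modulo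
  \<open>k\<close>, and \<open>1 - 2 * (1 - cos \<theta>) / k\<close> is nonnegative for every
  \<open>\<theta>\<close>.\<close>

locale dense_ring =
  fixes N k :: nat
  assumes four_le_k: "4 \<le> k" and k_less: "k < N" and N_less: "N < 2 * k"
begin

section \<open>The generator in terms of labels\<close>

text \<open>The two gaps beside each flipped label are interchanged, and flipped labels lie
  \<open>k\<close> apart, so no gap is affected twice.\<close>

lemma corner_flip_labelings:
  assumes x: "x \<in> labelings N k"
  shows "corner_flip k i x \<in> labelings N k"
proof -
  let ?k = "int k"
  have k0: "?k > 0" and k2: "?k \<ge> 4" using four_le_k by auto
  have "corner_flip k i x (m + ?k) = corner_flip k i x m + int N" for m
  proof -
    have "(m + ?k - i) mod ?k = (m - i) mod ?k"
      by (metis add_diff_eq add.commute add_diff_cancel_left' diff_add_eq mod_add_self2)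
    moreover have "x (m + ?k - 1) = x (m - 1) + int N" "x (m + ?k + 1) = x (m + 1) + int N"
      using labelings_period[OF x, of "m - 1"] labelings_period[OF x, of "m + 1"]
      by (auto simp: algebra_simps)
    ultimately show ?thesis using labelings_period[OF x, of m]
      by (auto simp: corner_flip_def)
  qed
  moreover have "corner_flip k i x (m + 1) - corner_flip k i x m \<in> {1, 2}" for m
  proof -
    have "(m + 1 - i) mod ?k = (if (m - i) mod ?k = ?k - 1 then 0 else (m - i) mod ?k + 1)"
      using mod_add_one_int[OF k0, of "m - i"] by (simp add: algebra_simps)
    then show ?thesis
      using labelings_gap[OF x, of m] labelings_gap[OF x, of "m + 1"] labelings_gap_left[OF x, of m] k2
        pos_mod_sign[OF k0, of "m - i"]
      by (auto simp: corner_flip_def)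
  qed
  ultimately show ?thesis by (simp add: labelings_def)
qed

text \<open>A jump on the circle lifts to a simultaneous move of one residue class of labels. Only
  this class sits on the source modulo \<open>N\<close>, so its move vacates the source.\<close>

lemma exchange_occupation:
  assumes x: "x \<in> labelings N k" and c: "c = 1 \<or> c = -1" and free: "x i + c \<notin> range x"
  shows "exchange (occupation N x) (x i mod int N) ((x i + c) mod int N)
    = occupation N (\<lambda>m. if (m - i) mod int k = 0 then x m + c else x m)"
    (is "_ = occupation N ?y")
proof
  fix z
  have N4: "int N > 4" using four_le_k k_less by auto
  have inj: "inj x" using labelings_strict_mono[OF x] by (rule strict_mono_imp_inj_on)
  have self: "(i + q * int k - i) mod int k = 0" for q by simp
  have xmod: "\<exists>q. m = i + q * int k" if "x m mod int N = x i mod int N" for m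
  proof -
    have "int N dvd x m - x i" using that by (metis mod_eq_dvd_iff)
    then obtain q where "x m = x i + q * int N" by (metis dvdE add.commute diff_add_cancel mult.commute)
    then have "x m = x (i + q * int k)" using labelings_period_mult[OF x] by simp
    then show ?thesis using inj by (auto dest: injD)
  qed
  have ne: "(x i + c) mod int N \<noteq> x i mod int N"
  proof
    assume "(x i + c) mod int N = x i mod int N"
    then have "int N dvd c" by (metis add_diff_cancel_left' mod_eq_dvd_iff)
    then show False using c N4 by (auto dest: zdvd_imp_le)
  qed
  show "exchange (occupation N x) (x i mod int N) ((x i + c) mod int N) z = occupation N ?y z"
  proof (cases "z \<in> circle N")
    case False
    then have "z \<noteq> (x i + c) mod int N" "z \<noteq> x i mod int N" using N4 by (auto simp: circle_def)
    then show ?thesis using False by (simp add: exchange_def occupation_def)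
  next
    case z: True
    then have zmod: "z mod int N = z" by (simp add: circle_def)
    consider "z = x i mod int N" | "z = (x i + c) mod int N"
      | "z \<noteq> x i mod int N" "z \<noteq> (x i + c) mod int N" by blast
    then show ?thesis
    proof cases
      case 1
      have "z \<notin> range ?y"
      proof
        assume "z \<in> range ?y"
        then obtain m where m: "z = ?y m" by (rule rangeE)
        show False
        proof (cases "(m - i) mod int k = 0")
          case True
          then obtain q where "m = i + q * int k" by (rule diff_mod_eq_0E)
          then have "z = x i + c + q * int N" using m labelings_period_mult[OF x] True by simp
          then have "z mod int N = (x i + c) mod int N" by simp
          then show False using ne 1 by simp
        next
          case False
          then have "x m = z" using m by simp
          then have "x m mod int N = x i mod int N" using 1 zmod by simp
          then show False using xmod False by fastforce
        qed
      qed
      then show ?thesis using 1 z ne occupation_mod[OF x, of "x i + c"] free N4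
        by (simp add: exchange_def occupation_def)
    next
      case 2
      have "z = x i + c + (- ((x i + c) div int N)) * int N"
        using 2 by (simp add: minus_div_mult_eq_mod[symmetric])
      then have "z = ?y (i + (- ((x i + c) div int N)) * int k)"
        using labelings_period_mult[OF x, of i "- ((x i + c) div int N)"]
          self[of "- ((x i + c) div int N)"] by simp
      then have "z \<in> range ?y" by blast
      then show ?thesis using 2 z occupation_mod[OF x, of "x i"] N4
        by (simp add: exchange_def occupation_def)
    next
      case 3
      have "z \<in> range x \<longleftrightarrow> z \<in> range ?y"
      proof
        assume "z \<in> range x"
        then obtain m where m: "z = x m" by auto
        have "(m - i) mod int k \<noteq> 0"
        proof
          assume "(m - i) mod int k = 0"
          then obtain q where "m = i + q * int k" by (rule diff_mod_eq_0E)
          then have "z = x i + q * int N" using m labelings_period_mult[OF x] by simp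
          then show False using 3(1) zmod by (metis mod_mult_self1)
        qed
        then have "z = ?y m" using m by simp
        then show "z \<in> range ?y" by blast
      next
        assume "z \<in> range ?y"
        then obtain m where m: "z = ?y m" by (rule rangeE)
        have "(m - i) mod int k \<noteq> 0"
        proof
          assume *: "(m - i) mod int k = 0"
          then obtain q where "m = i + q * int k" by (rule diff_mod_eq_0E)
          then have "z = x i + c + q * int N" using m labelings_period_mult[OF x] * by simp
          then show False using 3(2) zmod by (metis mod_mult_self1)
        qed
        then show "z \<in> range x" using m by simp
      qed
      then show ?thesis using 3 z by (simp add: exchange_def occupation_def)
    qed
  qed
qed

lemma corner_flip_up:
  assumes x: "x \<in> labelings N k" and "x i - x (i - 1) = 1" "x (i + 1) - x i = 2"
  shows "corner_flip k i x = (\<lambda>m. if (m - i) mod int k = 0 then x m + 1 else x m)"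
proof
  fix m
  show "corner_flip k i x m = (if (m - i) mod int k = 0 then x m + 1 else x m)"
  proof (cases "(m - i) mod int k = 0")
    case True
    then obtain q where q: "m = i + q * int k" by (rule diff_mod_eq_0E)
    have "x m = x i + q * int N" "x (m - 1) = x (i - 1) + q * int N" "x (m + 1) = x (i + 1) + q * int N"
      using labelings_period_mult[OF x, of _ q] unfolding q
      by (metis, metis diff_add_eq, metis add.commute add.left_commute)
    then show ?thesis using True assms by (simp add: corner_flip_def)
  qed (simp add: corner_flip_def)
qed

lemma corner_flip_down:
  assumes x: "x \<in> labelings N k" and "x i - x (i - 1) = 2" "x (i + 1) - x i = 1"
  shows "corner_flip k i x = (\<lambda>m. if (m - i) mod int k = 0 then x m + (-1) else x m)"
proof
  fix m
  show "corner_flip k i x m = (if (m - i) mod int k = 0 then x m + (-1) else x m)"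
  proof (cases "(m - i) mod int k = 0")
    case True
    then obtain q where q: "m = i + q * int k" by (rule diff_mod_eq_0E)
    have "x m = x i + q * int N" "x (m - 1) = x (i - 1) + q * int N" "x (m + 1) = x (i + 1) + q * int N"
      using labelings_period_mult[OF x, of _ q] unfolding q
      by (metis, metis diff_add_eq, metis add.commute add.left_commute)
    then show ?thesis using True assms by (simp add: corner_flip_def)
  qed (simp add: corner_flip_def)
qed

lemma corner_flip_flat:
  assumes x: "x \<in> labelings N k" and "x i - x (i - 1) = x (i + 1) - x i"
  shows "corner_flip k i x = x"
proof
  fix m
  show "corner_flip k i x m = x m"
  proof (cases "(m - i) mod int k = 0")
    case True
    then obtain q where q: "m = i + q * int k" by (rule diff_mod_eq_0E)
    have "x m = x i + q * int N" "x (m - 1) = x (i - 1) + q * int N" "x (m + 1) = x (i + 1) + q * int N"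
      using labelings_period_mult[OF x, of _ q] unfolding q
      by (metis, metis diff_add_eq, metis add.commute add.left_commute)
    then show ?thesis using True assms by (simp add: corner_flip_def)
  qed (simp add: corner_flip_def)
qed

text \<open>Any \<open>k\<close> consecutive labels span less than one turn. The start
  \<open>j\<close> is free so that sums can later begin at the first label of an arc.\<close>

lemma bij_betw_labels:
  assumes x: "x \<in> labelings N k"
  shows "bij_betw (\<lambda>i. x i mod int N) {j..<j + int k} (circle N \<inter> range x)"
  unfolding bij_betw_def
proof
  have sm: "strict_mono x" using labelings_strict_mono[OF x] .
  show "inj_on (\<lambda>i. x i mod int N) {j..<j + int k}"
  proof (rule inj_onI)
    fix a b assume ab: "a \<in> {j..<j + int k}" "b \<in> {j..<j + int k}"
      and eq: "x a mod int N = x b mod int N"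
    have "\<bar>x a - x b\<bar> < int N"
      using ab strict_mono_less_eq[OF sm, of j a] strict_mono_less_eq[OF sm, of j b]
        strict_mono_less[OF sm, of a "j + int k"] strict_mono_less[OF sm, of b "j + int k"]
        labelings_period[OF x, of j] by auto
    moreover have "int N dvd x a - x b" using eq by (metis mod_eq_dvd_iff)
    ultimately have "x a = x b" by (metis abs_of_nat dvd_imp_le_int eq_iff_diff_eq_0 not_le)
    then show "a = b" using strict_mono_eq[OF sm] by simp
  qed
  show "(\<lambda>i. x i mod int N) ` {j..<j + int k} = circle N \<inter> range x"
  proof (intro set_eqI iffI)
    fix z assume "z \<in> (\<lambda>i. x i mod int N) ` {j..<j + int k}"
    then show "z \<in> circle N \<inter> range x"
      using mem_range_labeling_mod[OF x] k_less by (auto simp: circle_def)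
  next
    fix z assume z: "z \<in> circle N \<inter> range x"
    then obtain m where m: "z = x m" by auto
    let ?i = "j + (m - j) mod int k"
    have "?i = m + (- ((m - j) div int k)) * int k"
      by (simp add: minus_div_mult_eq_mod[symmetric])
    then have "x ?i = z + (- ((m - j) div int k)) * int N"
      using labelings_period_mult[OF x] m by metis
    then have "x ?i mod int N = z mod int N" by (metis mod_mult_self1)
    then have "x ?i mod int N = z" using z by (simp add: circle_def)
    moreover have "?i \<in> {j..<j + int k}" using four_le_k by auto
    ultimately show "z \<in> (\<lambda>i. x i mod int N) ` {j..<j + int k}" by (metis image_eqI)
  qed
qed

text \<open>A particle has at most one positive jump rate: to the right for gaps (1, 2), to the left
  for gaps (2, 1). Each label thus contributes one flip at rate 1/2.\<close>

lemma sfep_generator_occupation: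
  assumes x: "x \<in> labelings N k"
  shows "sfep_generator N f (occupation N x)
    = (\<Sum>i\<in>{j..<j + int k}. 1/2 * (f (occupation N (corner_flip k i x)) - f (occupation N x)))"
proof -
  let ?o = "occupation N x"
  have N0: "N > 0" using k_less by simp
  \<comment> \<open>Every summand of the generator vanishes at holes, so both sums over sites become
    sums over labels.\<close>
  have red: "(\<Sum>y\<in>circle N. g y) = (\<Sum>i\<in>{j..<j + int k}. g (x i mod int N))"
    if "\<And>y. y \<in> circle N \<Longrightarrow> ?o y = 0 \<Longrightarrow> g y = 0" for g :: "int \<Rightarrow> real"
  proof -
    have "(\<Sum>y\<in>circle N. g y) = (\<Sum>y\<in>circle N \<inter> range x. g y)"
      using that by (intro sum.mono_neutral_right) (auto simp: circle_def occupation_def)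
    also have "\<dots> = (\<Sum>i\<in>{j..<j + int k}. g (x i mod int N))"
      using sum.reindex_bij_betw[OF bij_betw_labels[OF x, of j], of g] by simp
    finally show ?thesis .
  qed
  have *: "1/2 * real (?o (x i mod int N)) * real (?o (left_of N (x i mod int N)))
        * (1 - real (?o (right_of N (x i mod int N))))
        * (f (exchange ?o (x i mod int N) (right_of N (x i mod int N))) - f ?o)
      + 1/2 * real (?o (x i mod int N)) * real (?o (right_of N (x i mod int N)))
        * (1 - real (?o (left_of N (x i mod int N))))
        * (f (exchange ?o (x i mod int N) (left_of N (x i mod int N))) - f ?o)
      = 1/2 * (f (occupation N (corner_flip k i x)) - f ?o)" for i
  proof -
    have l: "left_of N (x i mod int N) = (x i - 1) mod int N"
      and r: "right_of N (x i mod int N) = (x i + 1) mod int N"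
      by (simp_all add: left_of_def right_of_def mod_simps)
    have v: "?o (x i mod int N) = 1"
        "?o ((x i - 1) mod int N) = (if x i - x (i - 1) = 1 then 1 else 0)"
        "?o ((x i + 1) mod int N) = (if x (i + 1) - x i = 1 then 1 else 0)"
      using occupation_mod[OF x N0] pred_mem_range_labeling[OF x] succ_mem_range_labeling[OF x]
      by auto
    consider "x i - x (i - 1) = 1" "x (i + 1) - x i = 2" | "x i - x (i - 1) = 2" "x (i + 1) - x i = 1"
      | "x i - x (i - 1) = x (i + 1) - x i"
      using labelings_gap[OF x, of i] labelings_gap_left[OF x, of i] by auto
    then show ?thesis
    proof cases
      case 1
      then have "x i + 1 \<notin> range x" using succ_mem_range_labeling[OF x, of i] by simp
      from exchange_occupation[OF x _ this] corner_flip_up[OF x 1] 1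
      show ?thesis by (simp add: l r v)
    next
      case 2
      then have "x i + (-1) \<notin> range x" using pred_mem_range_labeling[OF x, of i] by simp
      from exchange_occupation[OF x _ this] corner_flip_down[OF x 2] 2
      show ?thesis by (simp add: l r v)
    next
      \<comment> \<open>Equal gaps: both neighbours are occupied or both are empty, so all rates
        vanish, as does the increment of the flip.\<close>
      case 3
      then show ?thesis by (simp add: l r v corner_flip_flat[OF x 3])
    qed
  qed
  show ?thesis
    unfolding sfep_generator_def
    apply (subst red, simp)
    apply (subst red, simp)
    unfolding sum.distrib[symmetric] using * by (intro sum.cong refl) blast
qed


section \<open>Corner flips acting on arcs\<close>

text \<open>By linearity, flipping both labelings at the same label amounts to flipping their
  difference, so synchronous moves are read off the arc alone.\<close>

lemma corner_flip_add:
  "corner_flip k i (\<lambda>m. x m + a m) = (\<lambda>m. corner_flip k i x m + corner_flip k i a m)"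
  by (auto simp: corner_flip_def)

lemma arc_zero: "label_arc k j 0 = (\<lambda>_. 0)"
  using four_le_k by (auto simp: label_arc_def fun_eq_iff not_less)

lemma arc_full: "label_arc k j (int k) = (\<lambda>_. 1)"
  using four_le_k by (auto simp: label_arc_def fun_eq_iff)

lemma zero_less_k: "0 < int k"
  using four_le_k by simp

lemma label_mod_pred:
  "(p - 1 - j) mod int k = (if (p - j) mod int k = 0 then int k - 1 else (p - j) mod int k - 1)"
proof -
  have "p - 1 - j = (p - j) - 1" by simp
  then show ?thesis using mod_diff_one_int[of "int k" "p - j"] zero_less_k by (simp only:)
qed

lemma label_mod_succ:
  "(p + 1 - j) mod int k = (if (p - j) mod int k = int k - 1 then 0 else (p - j) mod int k + 1)"
proof -
  have "p + 1 - j = (p - j) + 1" by simp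
  then show ?thesis using mod_add_one_int[of "int k" "p - j"] zero_less_k by (simp only:)
qed

lemma arc_one: "label_arc k j 1 i = (if (i - j) mod int k = 0 then 1 else 0)"
proof -
  have "(i - j) mod int k \<ge> 0" using four_le_k by simp
  then have "(i - j) mod int k < 1 \<longleftrightarrow> (i - j) mod int k = 0" by linarith
  then show ?thesis by (simp add: label_arc_def)
qed

lemma arc_shrink_left:
  assumes "0 < d" "d \<le> int k"
  shows "label_arc k (j + 1) (d - 1) p = (if (p - j) mod int k = 0 then 0 else label_arc k j d p)"
proof -
  have "(p - (j + 1)) mod int k = (if (p - j) mod int k = 0 then int k - 1 else (p - j) mod int k - 1)"
    using label_mod_pred[of p j] by (simp only: diff_diff_add add.commute[of 1])
  then show ?thesis using assms by (auto simp: label_arc_def)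
qed

lemma arc_extend_left:
  assumes "0 \<le> d" "d < int k"
  shows "label_arc k (j - 1) (d + 1) p = (if (p - j) mod int k = int k - 1 then 1 else label_arc k j d p)"
proof -
  have "(p - (j - 1)) mod int k = (if (p - j) mod int k = int k - 1 then 0 else (p - j) mod int k + 1)"
    using label_mod_succ[of p j] by (simp only: diff_diff_eq2)
  then show ?thesis using assms by (auto simp: label_arc_def)
qed

lemma arc_shrink_right:
  "label_arc k j (d - 1) p = (if (p - j) mod int k = d - 1 then 0 else label_arc k j d p)"
  by (auto simp: label_arc_def)

lemma arc_extend_right:
  "label_arc k j (d + 1) p = (if (p - j) mod int k = d then 1 else label_arc k j d p)"
  by (auto simp: label_arc_def)

lemma corner_flip_arc:
  assumes m: "0 \<le> m" "m < int k"
  shows "corner_flip k (j + m) (label_arc k j d) p =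
    (if (p - j) mod int k = m
     then (if (if m = 0 then int k - 1 else m - 1) < d then 1 else 0)
        + (if (if m = int k - 1 then 0 else m + 1) < d then 1 else 0) - (if m < d then 1 else 0)
     else label_arc k j d p)"
proof -
  have "(p - (j + m)) mod int k = 0 \<longleftrightarrow> (p - j) mod int k = m mod int k"
    unfolding diff_diff_add[symmetric] by (rule diff_mod_eq_0_iff)
  then have e: "(p - (j + m)) mod int k = 0 \<longleftrightarrow> (p - j) mod int k = m" using m by simp
  show ?thesis unfolding corner_flip_def e label_arc_def label_mod_pred label_mod_succ by simp
qed

lemma corner_flip_arc_bulk:
  assumes "0 \<le> m" "m < int k" "m \<noteq> 0" "m \<noteq> d - 1" "m \<noteq> d" "m \<noteq> int k - 1"
  shows "corner_flip k (j + m) (label_arc k j d) = label_arc k j d"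
  using assms by (simp add: corner_flip_arc fun_eq_iff) (auto simp: label_arc_def)

text \<open>In this and the next three lemmas, flips at the four end labels move the boundary of the
  arc. The ranges of \<open>d\<close> exclude a single inner or outer label, whose flip would give
  the value -1 or 2.\<close>

lemma corner_flip_arc_first:
  assumes "2 \<le> d" "d < int k"
  shows "corner_flip k j (label_arc k j d) = label_arc k (j + 1) (d - 1)"
  using corner_flip_arc[of 0 j d] arc_shrink_left[of d j] assms four_le_k
  by (auto simp: fun_eq_iff)

lemma corner_flip_arc_last:
  assumes "2 \<le> d" "d < int k"
  shows "corner_flip k (j + (d - 1)) (label_arc k j d) = label_arc k j (d - 1)"
  using corner_flip_arc[of "d - 1" j d] arc_shrink_right[of j d] assms four_le_k
  by (auto simp: fun_eq_iff)

lemma corner_flip_arc_next: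
  assumes "1 \<le> d" "d < int k - 1"
  shows "corner_flip k (j + d) (label_arc k j d) = label_arc k j (d + 1)"
  using corner_flip_arc[of d j d] arc_extend_right[of j d] assms four_le_k
  by (auto simp: fun_eq_iff)

lemma corner_flip_arc_prev:
  assumes "1 \<le> d" "d < int k - 1"
  shows "corner_flip k (j + (int k - 1)) (label_arc k j d) = label_arc k (j - 1) (d + 1)"
  using corner_flip_arc[of "int k - 1" j d] arc_extend_left[of d j] assms four_le_k
  by (auto simp: fun_eq_iff)

text \<open>Both sequences have gaps in \<open>{1, 2}\<close>, which forces gaps (1, 2) of
  \<open>x\<close> around \<open>j\<close>. As the flip exchanges the pair, matching a flip in one
  copy with no flip in the other makes them coalesce.\<close>

lemma corner_flip_arc_single:
  assumes x: "x \<in> labelings N k" and y: "(\<lambda>i. x i + label_arc k j 1 i) \<in> labelings N k" (is "?y \<in> _")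
  shows "corner_flip k j x = ?y" "corner_flip k j ?y = x"
proof -
  have a: "label_arc k j 1 j = 1" "label_arc k j 1 (j - 1) = 0" "label_arc k j 1 (j + 1) = 0"
    using four_le_k by (simp_all add: arc_one zmod_minus1)
  have g: "x j - x (j - 1) = 1" "x (j + 1) - x j = 2"
    using labelings_gap_left[OF x, of j] labelings_gap[OF x, of j]
      labelings_gap_left[OF y, of j] labelings_gap[OF y, of j] a by auto
  show 1: "corner_flip k j x = ?y"
    unfolding corner_flip_up[OF x g] arc_one by auto
  show "corner_flip k j ?y = x"
  proof
    fix p
    have "corner_flip k j (label_arc k j 1) p = - label_arc k j 1 p"
      using corner_flip_arc[of 0 j 1 p] four_le_k by (simp add: arc_one[of j p])
    then show "corner_flip k j ?y p = x p" unfolding corner_flip_add 1 by simp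
  qed
qed

text \<open>The only label outside the arc has gaps (2, 1) in \<open>x\<close> and (1, 2) in the
  raised sequence. Flipping it in either copy alone completes the arc; flipping it in both would
  create a difference of 2.\<close>

lemma corner_flip_arc_all_but_one:
  assumes x: "x \<in> labelings N k"
    and y: "(\<lambda>i. x i + label_arc k j (int k - 1) i) \<in> labelings N k" (is "?y \<in> _")
  shows "corner_flip k (j + (int k - 1)) ?y = (\<lambda>i. x i + label_arc k j (int k) i)"
    "?y = (\<lambda>i. corner_flip k (j + (int k - 1)) x i + label_arc k j (int k) i)"
proof -
  let ?e = "j + (int k - 1)"
  have k4: "int k \<ge> 4" using four_le_k by simp
  have "- 1 mod int k = int k - 1" using k4 by (simp add: zmod_minus1)
  moreover have "- 2 mod int k = int k - 2"
    using mod_diff_one_int[of "int k" "- 1"] k4 calculation by simp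
  ultimately have a: "label_arc k j (int k - 1) ?e = 0" "label_arc k j (int k - 1) (?e - 1) = 1" "label_arc k j (int k - 1) (?e + 1) = 1"
    using k4 by (auto simp: label_arc_def)
  have g: "x ?e - x (?e - 1) = 2" "x (?e + 1) - x ?e = 1"
    using labelings_gap_left[OF x, of ?e] labelings_gap[OF x, of ?e]
      labelings_gap_left[OF y, of ?e] labelings_gap[OF y, of ?e] a by auto
  have e: "(p - ?e) mod int k = 0 \<longleftrightarrow> (p - j) mod int k = int k - 1" for p
  proof -
    have "(p - ?e) mod int k = 0 \<longleftrightarrow> (p - j) mod int k = (int k - 1) mod int k"
      unfolding diff_diff_add[symmetric, of p j] by (rule diff_mod_eq_0_iff)
    moreover have "(int k - 1) mod int k = int k - 1" using k4 by (intro mod_pos_pos_trivial) auto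
    ultimately show ?thesis by simp
  qed
  have lt: "(p - j) mod int k < int k - 1 \<longleftrightarrow> (p - j) mod int k \<noteq> int k - 1" for p
    using pos_mod_bound[of "int k" "p - j"] k4 by linarith
  have f: "corner_flip k ?e x p = (if (p - j) mod int k = int k - 1 then x p - 1 else x p)" for p
    unfolding corner_flip_down[OF x g] e by simp
  show "?y = (\<lambda>i. corner_flip k ?e x i + label_arc k j (int k) i)"
    unfolding arc_full f by (auto simp: label_arc_def lt)
  show "corner_flip k ?e ?y = (\<lambda>i. x i + label_arc k j (int k) i)"
    unfolding corner_flip_add arc_full using f corner_flip_arc[of "int k - 1" j "int k - 1"] k4
    by (auto simp: fun_eq_iff label_arc_def lt)
qed

section \<open>One step of the lazy chain\<close>

text \<open>The semigroup is the Poissonization at rate \<open>k\<close> of this discrete-time chain.\<close>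

definition lazy_step :: "(config \<Rightarrow> real) \<Rightarrow> config \<Rightarrow> real" where
  "lazy_step f \<xi> = f \<xi> + sfep_generator N f \<xi> / real k"

lemma lazy_step_occupation:
  assumes "x \<in> labelings N k"
  shows "lazy_step f (occupation N x) = (\<Sum>i\<in>{j..<j + int k}.
    (f (occupation N x) + f (occupation N (corner_flip k i x))) / 2) / real k"
proof -
  let ?c = "f (occupation N x)" and ?g = "\<lambda>i. f (occupation N (corner_flip k i x))"
  have *: "1/2 * (b - a) = (a + b) / 2 - a" for a b :: real by (simp add: field_simps)
  have "sfep_generator N f (occupation N x) = (\<Sum>i\<in>{j..<j + int k}. (?c + ?g i) / 2 - ?c)"
    unfolding sfep_generator_occupation[OF assms, of f j] by (rule sum.cong[OF refl]) (rule *)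
  also have "\<dots> = (\<Sum>i\<in>{j..<j + int k}. (?c + ?g i) / 2) - real k * ?c"
    by (simp only: sum_subtractf sum_constant) simp
  finally have "real k * ?c + sfep_generator N f (occupation N x)
      = (\<Sum>i\<in>{j..<j + int k}. (?c + ?g i) / 2)" by simp
  moreover have "lazy_step f (occupation N x)
      = (real k * ?c + sfep_generator N f (occupation N x)) / real k"
    unfolding lazy_step_def add_divide_distrib using four_le_k by simp
  ultimately show ?thesis by simp
qed

text \<open>Dual form of the coupling: instead of a joint process, the variation of \<open>f\<close>
  over coupled pairs is bounded, with \<open>w d\<close> as the cost of an arc of length
  \<open>d\<close>.\<close>

definition arc_modulus :: "(config \<Rightarrow> real) \<Rightarrow> (int \<Rightarrow> real) \<Rightarrow> bool" where
  "arc_modulus f w \<longleftrightarrow> (\<forall>x j d. x \<in> labelings N k \<longrightarrow> (\<lambda>i. x i + label_arc k j d i) \<in> labelings N k \<longrightarrow>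
     0 \<le> d \<longrightarrow> d \<le> int k \<longrightarrow>
     \<bar>f (occupation N x) - f (occupation N (\<lambda>i. x i + label_arc k j d i))\<bar> \<le> w d)"

lemma arc_modulusD:
  assumes "arc_modulus f w" "x \<in> labelings N k" "y \<in> labelings N k" "y = (\<lambda>i. x i + label_arc k j d i)"
    "0 \<le> d" "d \<le> int k"
  shows "\<bar>f (occupation N x) - f (occupation N y)\<bar> \<le> w d"
  using assms by (auto simp: arc_modulus_def)

text \<open>The bound is the mean of \<open>w\<close> after one step of the walk: two labels shrink
  the arc and two extend it, each picked with probability \<open>1 / k\<close> and flipped with
  probability 1/2.\<close>

lemma lazy_step_arc_modulus_inner:
  assumes f: "arc_modulus f w" and w0: "w 0 = 0"
    and x: "x \<in> labelings N k" and y: "(\<lambda>i. x i + label_arc k j d i) \<in> labelings N k" (is "?y \<in> _")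
    and d: "1 \<le> d" "d < int k"
  shows "\<bar>lazy_step f (occupation N x) - lazy_step f (occupation N ?y)\<bar>
    \<le> ((real k - 2) * w d + w (d - 1) + w (d + 1)) / real k"
proof -
  let ?F = "\<lambda>x. f (occupation N x)"
  let ?t = "\<lambda>i. (?F x + ?F (corner_flip k i x)) / 2 - (?F ?y + ?F (corner_flip k i ?y)) / 2"
  let ?lo = "(w (d - 1) - w d) / 2" and ?hi = "(w (d + 1) - w d) / 2"
  \<comment> \<open>For \<open>d = 1\<close> the two shrinking corrections fall on the same label
    and add up; for \<open>d = k - 1\<close> the two extending ones do.\<close>
  let ?b = "\<lambda>i. w d + (if i = j then ?lo else 0) + (if i = j + (d - 1) then ?lo else 0)
    + (if i = j + d then ?hi else 0) + (if i = j + (int k - 1) then ?hi else 0)"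
  have k4: "int k \<ge> 4" using four_le_k by simp
  note D = arc_modulusD[OF f]
  have base: "\<bar>?F x - ?F ?y\<bar> \<le> w d" using D[OF x y refl] d by simp
  have half: "\<bar>?t i\<bar> \<le> (w d + w e) / 2"
    if "corner_flip k i (label_arc k j d) = label_arc k l e" "0 \<le> e" "e \<le> int k" for i l e
  proof -
    have "\<bar>?F (corner_flip k i x) - ?F (corner_flip k i ?y)\<bar> \<le> w e"
      using D[OF corner_flip_labelings[OF x] corner_flip_labelings[OF y], of i i l e]
        corner_flip_add[of i x "label_arc k j d"] that by simp
    with base show ?thesis by (rule abs_diff_average_le)
  qed
  have t: "\<bar>?t i\<bar> \<le> ?b i" if i: "i \<in> {j..<j + int k}" for i
  proof -
    consider "i = j" "d = 1" | "i = j" "d \<ge> 2" | "i = j + (d - 1)" "d \<ge> 2"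
      | "i = j + d" "d < int k - 1" | "i = j + (int k - 1)" "d < int k - 1"
      | "i = j + (int k - 1)" "d = int k - 1"
      | "i \<noteq> j" "i \<noteq> j + (d - 1)" "i \<noteq> j + d" "i \<noteq> j + (int k - 1)"
      using d by linarith
    then show ?thesis
    proof cases
      \<comment> \<open>The averages agree because the flip swaps the two labelings; this is the
        absorption at 0.\<close>
      case 1
      have "?t i = 0" using corner_flip_arc_single[OF x] y 1 by simp
      moreover have "?b i = 0" using 1 w0 k4 by (simp add: field_simps)
      ultimately show ?thesis by simp
    next
      case 2
      have "corner_flip k i (label_arc k j d) = label_arc k (j + 1) (d - 1)"
        unfolding 2(1) by (rule corner_flip_arc_first) (use 2 d in auto)
      then have "\<bar>?t i\<bar> \<le> (w d + w (d - 1)) / 2" by (rule half) (use d in auto)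
      also have "(w d + w (d - 1)) / 2 = ?b i" using 2 d k4 by (auto simp: add_divide_distrib diff_divide_distrib)
      finally show ?thesis .
    next
      case 3
      have "corner_flip k i (label_arc k j d) = label_arc k j (d - 1)"
        unfolding 3(1) by (rule corner_flip_arc_last) (use 3 d in auto)
      then have "\<bar>?t i\<bar> \<le> (w d + w (d - 1)) / 2" by (rule half) (use d in auto)
      also have "(w d + w (d - 1)) / 2 = ?b i" using 3 d k4 by (auto simp: add_divide_distrib diff_divide_distrib)
      finally show ?thesis .
    next
      case 4
      have "corner_flip k i (label_arc k j d) = label_arc k j (d + 1)"
        unfolding 4(1) by (rule corner_flip_arc_next) (use 4 d in auto)
      then have "\<bar>?t i\<bar> \<le> (w d + w (d + 1)) / 2" by (rule half) (use d in auto)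
      also have "(w d + w (d + 1)) / 2 = ?b i" using 4 d k4 by (auto simp: add_divide_distrib diff_divide_distrib)
      finally show ?thesis .
    next
      case 5
      have "corner_flip k i (label_arc k j d) = label_arc k (j - 1) (d + 1)"
        unfolding 5(1) by (rule corner_flip_arc_prev) (use 5 d in auto)
      then have "\<bar>?t i\<bar> \<le> (w d + w (d + 1)) / 2" by (rule half) (use d in auto)
      also have "(w d + w (d + 1)) / 2 = ?b i" using 5 d k4 by (auto simp: add_divide_distrib diff_divide_distrib)
      finally show ?thesis .
    next
      \<comment> \<open>Opposite coins: keeping one copy is matched with flipping the other, and
        both outcomes differ by 1 everywhere.\<close>
      case 6
      note e = corner_flip_arc_all_but_one[OF x, of j]
      have y': "(\<lambda>i. x i + label_arc k j (int k - 1) i) \<in> labelings N k" using y 6 by simp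
      have "\<bar>?F x - ?F (corner_flip k i ?y)\<bar> \<le> w (d + 1)"
        using D[OF x corner_flip_labelings[OF y], of i j "int k"] e(1)[OF y'] 6 by simp
      moreover have "\<bar>?F (corner_flip k i x) - ?F ?y\<bar> \<le> w (d + 1)"
        using D[OF corner_flip_labelings[OF x] y, of i j "int k"] e(2)[OF y'] 6 by simp
      ultimately have "\<bar>?t i\<bar> \<le> (w (d + 1) + w (d + 1)) / 2"
        using abs_diff_average_le[of "?F x" "?F (corner_flip k i ?y)" "w (d + 1)"
          "?F (corner_flip k i x)" "?F ?y" "w (d + 1)"] by (simp only: add.commute[of "?F ?y"])
      also have "(w (d + 1) + w (d + 1)) / 2 = ?b i"
        using 6 k4 by (auto simp: add_divide_distrib diff_divide_distrib)
      finally show ?thesis .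
    next
      case 7
      have "corner_flip k (j + (i - j)) (label_arc k j d) = label_arc k j d"
        using 7 i by (intro corner_flip_arc_bulk) auto
      then show ?thesis using half[of i j d] 7 d by simp
    qed
  qed
  have "\<bar>\<Sum>i\<in>{j..<j + int k}. ?t i\<bar> \<le> (\<Sum>i\<in>{j..<j + int k}. ?b i)"
    using t by (intro order_trans[OF sum_abs] sum_mono) auto
  also have "\<dots> = real k * w d + ?lo + ?lo + ?hi + ?hi"
    using d k4 by (simp add: sum.distrib)
  also have "\<dots> = (real k - 2) * w d + w (d - 1) + w (d + 1)" by (simp add: field_simps)
  finally have "\<bar>\<Sum>i\<in>{j..<j + int k}. ?t i\<bar> \<le> (real k - 2) * w d + w (d - 1) + w (d + 1)" .
  then have "\<bar>(\<Sum>i\<in>{j..<j + int k}. ?t i) / real k\<bar>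
      \<le> ((real k - 2) * w d + w (d - 1) + w (d + 1)) / real k"
    unfolding abs_divide abs_of_nat by (rule divide_right_mono) simp
  moreover have "lazy_step f (occupation N x) - lazy_step f (occupation N ?y)
      = (\<Sum>i\<in>{j..<j + int k}. ?t i) / real k"
    unfolding lazy_step_occupation[OF x, of f j] lazy_step_occupation[OF y, of f j]
      diff_divide_distrib[symmetric] sum_subtractf[symmetric] by (rule refl)
  ultimately show ?thesis by (simp only:)
qed

section \<open>Chains of single raises\<close>

text \<open>
  From a label where \<open>x < y\<close>, gaps 1 of \<open>x\<close> propagate \<open>x < y\<close> to the right and gaps 2 propagate it
  to the left; neither kind of gap can fill a whole period.
\<close>

lemma exists_raisable_label:
  assumes x: "x \<in> labelings N k" and y: "y \<in> labelings N k" and lt: "x i0 < y i0"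
  shows "\<exists>i. x i < y i \<and> x i - x (i - 1) = 1 \<and> x (i + 1) - x i = 2"
proof -
  have "\<exists>i. x i < y i \<and> x (i + 1) - x i = 2"
  proof (rule ccontr)
    assume no: "\<not> ?thesis"
    have "x (i0 + int n) = x i0 + int n \<and> x (i0 + int n) < y (i0 + int n)" for n
    proof (induction n)
      case (Suc n)
      then have "x (i0 + int n + 1) - x (i0 + int n) = 1"
        using no labelings_gap[OF x, of "i0 + int n"] by blast
      then show ?case using Suc labelings_gap[OF y, of "i0 + int n"] by (auto simp: algebra_simps)
    qed (use lt in simp)
    from this[of k] show False using labelings_period[OF x, of i0] k_less by simp
  qed
  then obtain i1 where i1: "x i1 < y i1" "x (i1 + 1) - x i1 = 2" by blast
  show ?thesis
  proof (rule ccontr)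
    assume no: "\<not> ?thesis"
    have "x (i1 - int n) = x i1 - 2 * int n \<and> x (i1 - int n) < y (i1 - int n)
      \<and> x (i1 - int n + 1) - x (i1 - int n) = 2" for n
    proof (induction n)
      case (Suc n)
      then have "x (i1 - int n) - x (i1 - int n - 1) = 2"
        using no labelings_gap_left[OF x, of "i1 - int n"] by blast
      then show ?case using Suc labelings_gap_left[OF y, of "i1 - int n"] by (auto simp: algebra_simps)
    qed (use i1 in simp)
    from this[of k] show False using labelings_period[OF x, of "i1 - int k"] N_less by simp
  qed
qed

lemma labelings_mod:
  assumes "x \<in> labelings N k"
  shows "x i = x (i mod int k) + (i div int k) * int N"
  using labelings_period_mult[OF assms, of "i mod int k" "i div int k"] by simp

text \<open>Induction on the total height difference over one period. Raising a raisable label by 1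
  is a corner flip, hence gives a labeling again, and it stays weakly below \<open>y\<close>; each
  raise costs \<open>B\<close>.\<close>

lemma chain_bound:
  assumes B: "\<And>x i. x \<in> labelings N k \<Longrightarrow> (\<lambda>m. x m + label_arc k i 1 m) \<in> labelings N k \<Longrightarrow>
      \<bar>f (occupation N x) - f (occupation N (\<lambda>m. x m + label_arc k i 1 m))\<bar> \<le> B"
    and y: "y \<in> labelings N k"
  shows "x \<in> labelings N k \<Longrightarrow> (\<And>i. x i \<le> y i) \<Longrightarrow> (\<Sum>i\<in>{0..<int k}. y i - x i) = int n \<Longrightarrow>
    \<bar>f (occupation N x) - f (occupation N y)\<bar> \<le> real n * B"
proof (induction n arbitrary: x)
  case 0
  have "\<forall>i\<in>{0..<int k}. y i - x i = 0"
    using 0(2,3) sum_nonneg_eq_0_iff[of "{0..<int k}" "\<lambda>i. y i - x i"] by simp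
  then have "x (i mod int k) = y (i mod int k)" for i using four_le_k by auto
  then have "x i = y i" for i
    using labelings_mod[OF y, of i] labelings_mod[OF 0(1), of i] by simp
  then have "x = y" by (rule ext)
  then show ?case by simp
next
  case (Suc n)
  note x = Suc.prems(1) and le = Suc.prems(2)
  have "\<exists>i0. x i0 < y i0"
  proof (rule ccontr)
    assume "\<not> ?thesis"
    then have "(\<Sum>i\<in>{0..<int k}. y i - x i) = 0"
      using le by (intro sum.neutral) (auto simp: order_le_less)
    then show False using Suc.prems(3) by simp
  qed
  then obtain i where i: "x i < y i" "x i - x (i - 1) = 1" "x (i + 1) - x i = 2"
    using exists_raisable_label[OF x y] by blast
  let ?z = "\<lambda>m. x m + label_arc k i 1 m"
  have "corner_flip k i x = ?z"
    unfolding corner_flip_up[OF x i(2,3)] arc_one by auto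
  then have z: "?z \<in> labelings N k" using corner_flip_labelings[OF x, of i] by simp
  have zle: "?z m \<le> y m" for m
  proof (cases "(m - i) mod int k = 0")
    case True
    then obtain q where "m = i + q * int k" by (rule diff_mod_eq_0E)
    then show ?thesis
      using labelings_period_mult[OF x, of i q] labelings_period_mult[OF y, of i q] i arc_one by simp
  qed (use le arc_one in simp)
  have "(m - i) mod int k = 0 \<longleftrightarrow> m = i mod int k" if "m \<in> {0..<int k}" for m
    unfolding diff_mod_eq_0_iff using that by simp
  then have "(\<Sum>m\<in>{0..<int k}. label_arc k i 1 m) = (\<Sum>m\<in>{0..<int k}. if m = i mod int k then 1 else 0)"
    by (intro sum.cong) (auto simp: arc_one)
  also have "\<dots> = 1" using four_le_k by (simp add: sum.delta)
  finally have "(\<Sum>m\<in>{0..<int k}. y m - ?z m) = int n"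
    using Suc.prems(3) by (simp add: sum_subtractf sum.distrib)
  from Suc.IH[OF z zle this] B[OF x z]
  show ?case by (simp add: algebra_simps)
qed

lemma occupation_cong_range: "range x = range y \<Longrightarrow> occupation N x = occupation N y"
  by (simp add: occupation_def)

lemma occupation_add_period:
  assumes x: "x \<in> labelings N k"
  shows "occupation N (\<lambda>i. x i + int N) = occupation N x"
proof (rule occupation_cong_range)
  have "range (\<lambda>i. x i + int N) = x ` range (\<lambda>i. i + int k)"
    unfolding image_image using labelings_period[OF x] by simp
  also have "range (\<lambda>i. i + int k) = UNIV" by (rule surj_plus_right)
  finally show "range (\<lambda>i. x i + int N) = range x" .
qed

lemma labelings_add_const: "x \<in> labelings N k \<Longrightarrow> (\<lambda>i. x i + c) \<in> labelings N k"
  by (simp add: labelings_def)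

text \<open>
  Relabelling turns the translate \<open>x + 1\<close> into \<open>x (i - 1) + 1\<close>, which lies below \<open>x\<close> and differs
  from it by 1 at only \<open>N - k\<close> labels per period.
\<close>

lemma translate_bound:
  assumes B: "\<And>x i. x \<in> labelings N k \<Longrightarrow> (\<lambda>m. x m + label_arc k i 1 m) \<in> labelings N k \<Longrightarrow>
      \<bar>f (occupation N x) - f (occupation N (\<lambda>m. x m + label_arc k i 1 m))\<bar> \<le> B"
    and x: "x \<in> labelings N k"
  shows "\<bar>f (occupation N x) - f (occupation N (\<lambda>i. x i + 1))\<bar> \<le> real (N - k) * B"
proof -
  let ?z = "\<lambda>i. x (i - 1) + 1"
  have z: "?z \<in> labelings N k"
  proof -
    have "x (i + int k - 1) = x (i - 1) + int N" for i
      using labelings_period[OF x, of "i - 1"] by (simp only: diff_add_eq)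
    moreover have "x (i + 1 - 1) - x (i - 1) \<in> {1, 2}" for i using labelings_gap_left[OF x, of i] by auto
    ultimately show ?thesis by (simp add: labelings_def)
  qed
  have le: "?z i \<le> x i" for i using labelings_gap_left[OF x, of i] by auto
  \<comment> \<open>Each summand is a gap minus 1, the number of holes in that gap; the sum
    telescopes and over one period counts the \<open>N - k\<close> holes.\<close>
  have tel: "(\<Sum>i\<in>{0..<int n}. x i - ?z i) = x (int n - 1) - x (-1) - int n" for n
  proof (induction n)
    case (Suc n)
    have "{0..<int (Suc n)} = insert (int n) {0..<int n}" by auto
    then show ?case using Suc by simp
  qed simp
  have "x (int k - 1) = x (-1) + int N" using labelings_period[OF x, of "-1"] by simp
  then have "(\<Sum>i\<in>{0..<int k}. x i - ?z i) = int (N - k)" using tel[of k] k_less by simp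
  from chain_bound[OF B x z le this]
  have "\<bar>f (occupation N ?z) - f (occupation N x)\<bar> \<le> real (N - k) * B" .
  moreover have "occupation N ?z = occupation N (\<lambda>i. x i + 1)"
  proof (rule occupation_cong_range)
    have "range ?z = (\<lambda>i. x i + 1) ` range (\<lambda>i. i - 1)" unfolding image_image by simp
    also have "range (\<lambda>i::int. i - 1) = UNIV" by (metis add_diff_cancel surjI)
    finally show "range ?z = range (\<lambda>i. x i + 1)" .
  qed
  ultimately show ?thesis by (simp add: abs_minus_commute)
qed

section \<open>Contraction of the sine weight\<close>

text \<open>For \<open>1 \<le> d < k\<close> the sine is an eigenfunction of the walk, by the
  addition formula. At \<open>d = k\<close> no walk step is taken: the contracted bound for
  \<open>d = 1\<close> is applied along \<open>N - k\<close> raises, and the hypothesis on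
  \<open>\<theta>\<close> brings the result below the weight at \<open>k\<close>.\<close>

lemma lazy_step_arc_modulus:
  fixes \<theta> A :: real
  assumes f: "arc_modulus f (\<lambda>d. A * sin (\<theta> * d))" and A: "A \<ge> 0"
    and \<theta>: "real (N - k) * sin \<theta> \<le> sin (\<theta> * k)"
  shows "arc_modulus (lazy_step f) (\<lambda>d. A * (1 - 2 * (1 - cos \<theta>) / k) * sin (\<theta> * d))"
proof -
  let ?q = "1 - 2 * (1 - cos \<theta>) / k"
  let ?F = "\<lambda>x. lazy_step f (occupation N x)"
  have k4: "real k \<ge> 4" using four_le_k by simp
  have "2 * (1 - cos \<theta>) \<le> 4"
    unfolding right_diff_distrib using cos_ge_minus_one[of \<theta>] by linarith
  then have q: "?q \<ge> 0" using k4 by simp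
  have inner: "\<bar>?F x - ?F (\<lambda>i. x i + label_arc k j d i)\<bar> \<le> A * ?q * sin (\<theta> * d)"
    if "x \<in> labelings N k" "(\<lambda>i. x i + label_arc k j d i) \<in> labelings N k" "1 \<le> d" "d < int k" for x j d
  proof -
    have "\<theta> * real_of_int (d - 1) = \<theta> * d - \<theta>" "\<theta> * real_of_int (d + 1) = \<theta> * d + \<theta>"
      by (simp_all add: algebra_simps)
    then have "A * sin (\<theta> * real_of_int (d - 1)) + A * sin (\<theta> * real_of_int (d + 1))
        = 2 * cos \<theta> * (A * sin (\<theta> * d))"
      by (simp only: sin_add sin_diff) (simp add: algebra_simps)
    then have "((real k - 2) * (A * sin (\<theta> * d)) + A * sin (\<theta> * real_of_int (d - 1))
          + A * sin (\<theta> * real_of_int (d + 1))) / k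
        = (real k - 2 + 2 * cos \<theta>) / k * (A * sin (\<theta> * d))"
      by (simp add: algebra_simps)
    also have "(real k - 2 + 2 * cos \<theta>) / k = ?q" using k4 by (simp add: field_simps)
    finally show ?thesis using lazy_step_arc_modulus_inner[OF f _ that] by (simp add: mult_ac)
  qed
  have single: "\<bar>?F x - ?F (\<lambda>m. x m + label_arc k i 1 m)\<bar> \<le> A * ?q * sin \<theta>"
    if "x \<in> labelings N k" "(\<lambda>m. x m + label_arc k i 1 m) \<in> labelings N k" for x i
    using inner[OF that] four_le_k by simp
  show ?thesis
    unfolding arc_modulus_def
  proof (intro allI impI)
    fix x j and d :: int
    assume x: "x \<in> labelings N k" "(\<lambda>i. x i + label_arc k j d i) \<in> labelings N k" and d: "0 \<le> d" "d \<le> int k"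
    consider "d = 0" | "1 \<le> d" "d < int k" | "d = int k" using d by linarith
    then show "\<bar>?F x - ?F (\<lambda>i. x i + label_arc k j d i)\<bar> \<le> A * ?q * sin (\<theta> * d)"
    proof cases
      case 1
      then show ?thesis by (simp add: arc_zero)
    next
      case 2
      then show ?thesis using inner[OF x] by blast
    next
      case 3
      have "\<bar>?F x - ?F (\<lambda>i. x i + 1)\<bar> \<le> real (N - k) * (A * ?q * sin \<theta>)"
        using translate_bound[OF single x(1)] .
      also have "\<dots> = A * ?q * (real (N - k) * sin \<theta>)" by (simp only: mult_ac)
      also have "\<dots> \<le> A * ?q * sin (\<theta> * k)" using A q \<theta> by (intro mult_left_mono) auto
      finally show ?thesis using 3 by (simp add: arc_full)
    qed
  qed
qed

lemma lazy_step_iterate_arc_modulus: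
  fixes \<theta> A :: real
  assumes f: "arc_modulus f (\<lambda>d. A * sin (\<theta> * d))" and A: "A \<ge> 0"
    and \<theta>: "real (N - k) * sin \<theta> \<le> sin (\<theta> * k)"
  shows "arc_modulus ((lazy_step ^^ n) f) (\<lambda>d. A * (1 - 2 * (1 - cos \<theta>) / k) ^ n * sin (\<theta> * d))"
proof (induction n)
  case 0
  show ?case using f by simp
next
  case (Suc n)
  have "2 * (1 - cos \<theta>) \<le> 4"
    unfolding right_diff_distrib using cos_ge_minus_one[of \<theta>] by linarith
  then have "1 - 2 * (1 - cos \<theta>) / k \<ge> 0" using four_le_k by simp
  then have "A * (1 - 2 * (1 - cos \<theta>) / k) ^ n \<ge> 0" using A by simp
  from lazy_step_arc_modulus[OF Suc this \<theta>] show ?case by (simp add: mult_ac)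
qed

text \<open>The factor \<open>1 / sin \<theta>\<close> gives weight 1 at \<open>d = 1\<close>. As
  the sine increases up to \<open>pi / 2\<close>, longer arcs weigh at least 1, the largest
  variation of an indicator.\<close>

lemma indicator_arc_modulus:
  fixes \<theta> :: real
  assumes \<theta>: "0 < \<theta>" "\<theta> * k \<le> pi / 2"
  shows "arc_modulus (indicator S) (\<lambda>d. 1 / sin \<theta> * sin (\<theta> * d))"
  unfolding arc_modulus_def
proof (intro allI impI)
  fix x j and d :: int
  assume d: "0 \<le> d" "d \<le> int k"
  have "\<theta> * 1 \<le> \<theta> * k" using \<theta> four_le_k by (intro mult_left_mono) auto
  then have "\<theta> < pi" using \<theta> pi_gt_zero by linarith
  then have pos: "sin \<theta> > 0" using \<theta> by (intro sin_gt_zero) auto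
  show "\<bar>indicator S (occupation N x) - indicator S (occupation N (\<lambda>i. x i + label_arc k j d i))\<bar>
      \<le> 1 / sin \<theta> * sin (\<theta> * real_of_int d)"
  proof (cases "d = 0")
    case True
    then show ?thesis by (simp add: arc_zero)
  next
    case False
    then have "\<theta> * 1 \<le> \<theta> * d" using \<theta> d by (intro mult_left_mono) auto
    moreover have "\<theta> * d \<le> \<theta> * k" using \<theta> d by (intro mult_left_mono) auto
    ultimately have "- (pi / 2) \<le> \<theta>" "\<theta> \<le> \<theta> * d" "\<theta> * d \<le> pi / 2"
      using \<theta> pi_gt_zero by linarith+
    then have "sin \<theta> \<le> sin (\<theta> * d)" by (rule sin_monotone_2pi_le)
    then have "1 \<le> 1 / sin \<theta> * sin (\<theta> * d)" using pos by simp
    moreover have "\<bar>indicator S (occupation N x)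
        - indicator S (occupation N (\<lambda>i. x i + label_arc k j d i))\<bar> \<le> (1::real)"
      by (auto simp: indicator_def)
    ultimately show ?thesis by linarith
  qed
qed

section \<open>Ergodic configurations as labelings\<close>

lemma right_of_circle: "y \<in> circle N \<Longrightarrow> right_of N y = (if y = int N - 1 then 0 else y + 1)"
  by (auto simp: circle_def right_of_def)

lemma left_of_circle: "y \<in> circle N \<Longrightarrow> left_of N y = (if y = 0 then int N - 1 else y - 1)"
  using mod_diff_one_int[of "int N" y] by (auto simp: circle_def left_of_def)

lemma ergodic_component_value:
  assumes "\<xi> \<in> ergodic_component N k" "y \<in> circle N"
  shows "\<xi> y = 0 \<or> \<xi> y = 1"
  using assms by (auto simp: ergodic_component_def configs_def PiE_def Pi_def)

text \<open>The particles of one turn are listed in increasing order and continued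
  quasi-periodically; a gap of 3 or more would contain two adjacent holes. The bounds make any two
  such labelings comparable after adding \<open>N\<close>.\<close>

lemma exists_labeling:
  assumes \<xi>: "\<xi> \<in> ergodic_component N k"
  shows "\<exists>x\<in>labelings N k. occupation N x = \<xi> \<and> (\<forall>i\<in>{0..<int k}. 0 \<le> x i \<and> x i < int N)"
proof -
  define P where "P = {y \<in> circle N. \<xi> y = 1}"
  define s where "s = sorted_list_of_set P"
  define x where "x i = s ! nat (i mod int k) + (i div int k) * int N" for i
  have N0: "int N > 0" and k0: "int k > 0" using k_less four_le_k by auto
  have fin: "finite P" by (rule finite_subset[of _ "circle N"]) (auto simp: P_def circle_def)
  have "(\<Sum>y\<in>circle N. \<xi> y) = (\<Sum>y\<in>circle N. if \<xi> y = 1 then 1 else 0)"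
    using ergodic_component_value[OF \<xi>] by (intro sum.cong) auto
  then have "card P = k"
    using \<xi> by (simp add: P_def ergodic_component_def configs_def sum.If_cases circle_def Int_def)
  then have len: "length s = k" by (simp add: s_def)
  have set: "set s = P" using fin by (simp add: s_def)
  have mem: "s ! nat (i mod int k) \<in> P" for i
  proof -
    have "nat (i mod int k) < k" using k0 by (simp add: nat_less_iff)
    then show ?thesis using nth_mem[of "nat (i mod int k)" s] len set by simp
  qed
  have bnd: "0 \<le> s ! nat (i mod int k)" "s ! nat (i mod int k) < int N" for i
    using mem[of i] by (auto simp: P_def circle_def)
  have per: "x (i + int k) = x i + int N" for i
    using k0 by (simp add: x_def algebra_simps)
  have step: "x i < x (i + 1)" for i
  proof (cases "i mod int k = int k - 1")
    case True
    have "i = i div int k * int k + (int k - 1)"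
      using div_mult_mod_eq[of i "int k"] unfolding True by (rule sym)
    then have "i + 1 = (i div int k + 1) * int k" unfolding distrib_right by linarith
    then have d: "(i + 1) div int k = i div int k + 1"
      using k0 by (metis nonzero_mult_div_cancel_right order_less_irrefl)
    show ?thesis using bnd[of i] bnd[of "i + 1"] unfolding x_def d distrib_right by linarith
  next
    case False
    have m: "(i + 1) mod int k = i mod int k + 1" using mod_add_one_int[OF k0, of i] False by simp
    then have lt: "i mod int k + 1 < int k" using pos_mod_bound[OF k0, of "i + 1"] by simp
    have d: "(i + 1) div int k = i div int k"
    proof (rule int_div_pos_eq)
      show "i + 1 = int k * (i div int k) + (i mod int k + 1)" by simp
    qed (use lt k0 in auto)
    have n: "nat (i mod int k + 1) = Suc (nat (i mod int k))" using k0 by (simp add: nat_add_distrib)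
    have "sorted_wrt (<) s" unfolding s_def by (rule strict_sorted_list_of_set)
    moreover have "Suc (nat (i mod int k)) < length s"
      unfolding n[symmetric] len using lt k0 by (simp add: nat_less_iff)
    ultimately have "s ! nat (i mod int k) < s ! Suc (nat (i mod int k))"
      using sorted_wrt_nth_less[of "(<)" s "nat (i mod int k)" "Suc (nat (i mod int k))"] by simp
    then show ?thesis unfolding x_def d m n by simp
  qed
  have sm: "strict_mono x" using step by (rule strict_mono_intI)
  have rng: "z \<in> range x \<longleftrightarrow> z mod int N \<in> P" for z
  proof
    assume "z \<in> range x"
    then obtain i where "z = x i" by blast
    then have "z mod int N = s ! nat (i mod int k)" using bnd[of i] by (simp add: x_def)
    then show "z mod int N \<in> P" using mem by simp
  next
    assume "z mod int N \<in> P"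
    then obtain m where m: "m < k" "s ! m = z mod int N" using set len by (metis in_set_conv_nth)
    have "x (int m + (z div int N) * int k) = z" using m by (simp add: x_def)
    then show "z \<in> range x" by (metis rangeI)
  qed
  have gap: "x (i + 1) - x i \<in> {1, 2}" for i
  proof (rule ccontr)
    assume "x (i + 1) - x i \<notin> {1, 2}"
    then have big: "x (i + 1) \<ge> x i + 3" using step[of i] by auto
    have free: "z mod int N \<notin> P" if "x i < z" "z < x (i + 1)" for z
    proof
      assume "z mod int N \<in> P"
      then obtain j where j: "z = x j" using rng by blast
      then have "i < j" "j < i + 1" using that strict_mono_less[OF sm] by auto
      then show False by simp
    qed
    let ?z = "(x i + 1) mod int N"
    have z: "?z \<in> circle N" "right_of N ?z = (x i + 2) mod int N" "right_of N ?z \<in> circle N"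
      using N0 by (simp_all add: circle_def right_of_def mod_simps add.commute)
    have "?z \<notin> P" "right_of N ?z \<notin> P" using free[of "x i + 1"] free[of "x i + 2"] big z(2) by auto
    then have "\<xi> ?z = 0" "\<xi> (right_of N ?z) = 0"
      using z ergodic_component_value[OF \<xi>] by (auto simp: P_def)
    then show False using \<xi> z(1) by (auto simp: ergodic_component_def)
  qed
  have "x \<in> labelings N k" using per gap by (simp add: labelings_def)
  moreover have "occupation N x = \<xi>"
  proof
    fix z
    show "occupation N x z = \<xi> z"
    proof (cases "z \<in> circle N")
      case True
      then have "z \<in> range x \<longleftrightarrow> \<xi> z = 1" using rng[of z] by (simp add: P_def circle_def)
      then show ?thesis using True ergodic_component_value[OF \<xi> True] by (auto simp: occupation_def)
    next
      case False
      then show ?thesis using \<xi>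
        by (auto simp: occupation_def ergodic_component_def configs_def PiE_def extensional_def)
    qed
  qed
  moreover have "0 \<le> x i \<and> x i < int N" if "i \<in> {0..<int k}" for i
    using bnd[of i] that by (simp add: x_def)
  ultimately show ?thesis by blast
qed

lemma lazy_step_iterate_oscillation:
  fixes \<theta> :: real
  assumes \<theta>: "0 < \<theta>" "\<theta> * k \<le> pi / 2" and h: "real (N - k) * sin \<theta> \<le> sin (\<theta> * k)"
    and \<xi>: "\<xi> \<in> ergodic_component N k" and \<eta>: "\<eta> \<in> ergodic_component N k"
  shows "\<bar>(lazy_step ^^ n) (indicator S) \<xi> - (lazy_step ^^ n) (indicator S) \<eta>\<bar>
    \<le> 2 * real N * real k * (1 - 2 * (1 - cos \<theta>) / k) ^ n"
proof -
  let ?g = "(lazy_step ^^ n) (indicator S)"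
  let ?B = "(1 - 2 * (1 - cos \<theta>) / k) ^ n"
  have "\<theta> * 1 \<le> \<theta> * k" using \<theta> four_le_k by (intro mult_left_mono) auto
  then have "\<theta> < pi" using \<theta> pi_gt_zero by linarith
  then have pos: "sin \<theta> > 0" using \<theta> by (intro sin_gt_zero) auto
  have "2 * (1 - cos \<theta>) \<le> 4"
    unfolding right_diff_distrib using cos_ge_minus_one[of \<theta>] by linarith
  then have "1 - 2 * (1 - cos \<theta>) / k \<ge> 0" using four_le_k by simp
  then have B0: "?B \<ge> 0" by simp
  have mod: "arc_modulus ?g (\<lambda>d. 1 / sin \<theta> * ?B * sin (\<theta> * d))"
    using lazy_step_iterate_arc_modulus[OF indicator_arc_modulus[OF \<theta>] _ h] pos by simp
  have B: "\<bar>?g (occupation N x) - ?g (occupation N (\<lambda>m. x m + label_arc k i 1 m))\<bar> \<le> ?B"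
    if "x \<in> labelings N k" "(\<lambda>m. x m + label_arc k i 1 m) \<in> labelings N k" for x i
    using arc_modulusD[OF mod that refl] four_le_k pos by simp
  obtain x where x: "x \<in> labelings N k" "occupation N x = \<xi>" "\<forall>i\<in>{0..<int k}. 0 \<le> x i \<and> x i < int N"
    using exists_labeling[OF \<xi>] by blast
  obtain y where y: "y \<in> labelings N k" "occupation N y = \<eta>" "\<forall>i\<in>{0..<int k}. 0 \<le> y i \<and> y i < int N"
    using exists_labeling[OF \<eta>] by blast
  \<comment> \<open>Adding a full turn keeps the configuration and lifts \<open>y\<close> above
    \<open>x\<close>; each of the \<open>k\<close> height differences is then at most
    \<open>2 * N\<close>.\<close>
  let ?y = "\<lambda>i. y i + int N"
  have m: "i mod int k \<in> {0..<int k}" for i using four_le_k by auto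
  have le: "x i \<le> ?y i" for i
  proof -
    have "x (i mod int k) < int N" "0 \<le> y (i mod int k)" using x(3) y(3) m[of i] by auto
    then show ?thesis using labelings_mod[OF x(1), of i] labelings_mod[OF y(1), of i] by linarith
  qed
  let ?S = "\<Sum>i\<in>{0..<int k}. ?y i - x i"
  have "?S \<ge> 0" using le by (intro sum_nonneg) simp
  then have S: "?S = int (nat ?S)" by simp
  have "?S \<le> (\<Sum>i\<in>{0..<int k}. 2 * int N)"
  proof (rule sum_mono)
    fix i assume "i \<in> {0..<int k}"
    then have "0 \<le> x i" "y i < int N" using x(3) y(3) by auto
    then show "?y i - x i \<le> 2 * int N" by linarith
  qed
  then have "nat ?S \<le> 2 * N * k" by (simp add: nat_le_iff mult_ac)
  then have "real (nat ?S) \<le> real (2 * N * k)" by (rule of_nat_mono)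
  then have "real (nat ?S) * ?B \<le> 2 * real N * real k * ?B"
    using B0 by (intro mult_right_mono) simp_all
  moreover have "\<bar>?g (occupation N x) - ?g (occupation N ?y)\<bar> \<le> real (nat ?S) * ?B"
    using chain_bound[OF B labelings_add_const[OF y(1)] x(1) le S] .
  ultimately show ?thesis
    unfolding occupation_add_period[OF y(1)] x(2) y(2) by linarith
qed

section \<open>Invariance of the uniform distribution\<close>

text \<open>With both outer neighbours of the edge occupied, its hole lies between particles before
  and after the swap.\<close>

lemma exchange_ergodic_component:
  assumes \<xi>: "\<xi> \<in> ergodic_component N k" and y: "y \<in> circle N"
    and l: "\<xi> (left_of N y) = 1" and r: "\<xi> (right_of N (right_of N y)) = 1"
    and ne: "\<xi> y \<noteq> \<xi> (right_of N y)"
  shows "exchange \<xi> y (right_of N y) \<in> ergodic_component N k"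
proof -
  let ?r = "right_of N y" let ?\<eta> = "exchange \<xi> y ?r"
  have N5: "int N > 4" using four_le_k k_less by simp
  have rc: "right_of N z \<in> circle N" for z using N5 by (simp add: right_of_def circle_def)
  have yr: "y \<noteq> ?r" using N5 y by (auto simp: right_of_circle)
  have fin: "finite (circle N)" by (simp add: circle_def)
  have dec: "(\<Sum>z\<in>circle N. g z) = g y + g ?r + (\<Sum>z\<in>circle N - {y, ?r}. g z)" for g :: "int \<Rightarrow> nat"
  proof -
    have "(\<Sum>z\<in>circle N. g z) = g y + (\<Sum>z\<in>circle N - {y}. g z)" using fin y by (rule sum.remove)
    also have "(\<Sum>z\<in>circle N - {y}. g z) = g ?r + (\<Sum>z\<in>circle N - {y} - {?r}. g z)"
      using fin rc[of y] yr by (intro sum.remove) auto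
    also have "circle N - {y} - {?r} = circle N - {y, ?r}" by auto
    finally show ?thesis by simp
  qed
  have "(\<Sum>z\<in>circle N - {y, ?r}. ?\<eta> z) = (\<Sum>z\<in>circle N - {y, ?r}. \<xi> z)"
    by (intro sum.cong) (auto simp: exchange_def)
  then have "(\<Sum>z\<in>circle N. ?\<eta> z) = (\<Sum>z\<in>circle N. \<xi> z)"
    unfolding dec using yr by (simp add: exchange_def)
  moreover have "?\<eta> \<in> circle N \<rightarrow>\<^sub>E {0, 1}"
    using \<xi> y rc[of y] by (auto simp: ergodic_component_def configs_def PiE_def Pi_def exchange_def extensional_def)
  moreover have "?\<eta> z + ?\<eta> (right_of N z) \<ge> 1" if z: "z \<in> circle N" for z
  proof -
    have one: "\<xi> y = 1 \<or> \<xi> ?r = 1"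
      using ne ergodic_component_value[OF \<xi> y] ergodic_component_value[OF \<xi> rc[of y]] by auto
    consider "z = left_of N y" | "z = y" | "z = ?r" | "z \<noteq> left_of N y" "z \<noteq> y" "z \<noteq> ?r" by blast
    then show ?thesis
    proof cases
      case 1
      then have "z \<noteq> y" "z \<noteq> ?r" using y N5 by (auto simp: left_of_circle right_of_circle split: if_splits)
      then show ?thesis using 1 l by (simp add: exchange_def)
    next
      case 2
      then show ?thesis using one yr by (auto simp: exchange_def)
    next
      case 3
      then have "right_of N z \<noteq> y" "right_of N z \<noteq> ?r"
        using y rc[of y] N5 by (auto simp: right_of_circle circle_def split: if_splits)
      then show ?thesis using 3 r by (simp add: exchange_def)
    next
      case 4
      then have "right_of N z \<noteq> y" "right_of N z \<noteq> ?r"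
        using y z N5 by (auto simp: right_of_circle left_of_circle circle_def split: if_splits)
      then show ?thesis using 4 \<xi> z by (simp add: exchange_def ergodic_component_def)
    qed
  qed
  ultimately show ?thesis using \<xi> by (simp add: ergodic_component_def configs_def)
qed

text \<open>Merges the jumps in both directions across one edge. The condition is symmetric under
  the swap, so that the map is an involution.\<close>

definition edge_swap :: "int \<Rightarrow> config \<Rightarrow> config" where
  "edge_swap y \<xi> = (if \<xi> (left_of N y) = 1 \<and> \<xi> (right_of N (right_of N y)) = 1 \<and> \<xi> y \<noteq> \<xi> (right_of N y)
     then exchange \<xi> y (right_of N y) else \<xi>)"

lemma edge_swap_ergodic_component:
  "\<xi> \<in> ergodic_component N k \<Longrightarrow> y \<in> circle N \<Longrightarrow> edge_swap y \<xi> \<in> ergodic_component N k"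
  using exchange_ergodic_component by (simp add: edge_swap_def)

lemma edge_swap_involution:
  assumes y: "y \<in> circle N"
  shows "edge_swap y (edge_swap y \<xi>) = \<xi>"
proof -
  let ?r = "right_of N y"
  have N5: "int N > 4" using four_le_k k_less by simp
  have rc: "?r \<in> circle N" using N5 by (simp add: right_of_def circle_def)
  have "y \<noteq> ?r" "left_of N y \<noteq> y" "left_of N y \<noteq> ?r" "right_of N ?r \<noteq> y" "right_of N ?r \<noteq> ?r"
    using y rc N5 by (auto simp: right_of_circle left_of_circle circle_def split: if_splits)
  then show ?thesis by (auto simp: edge_swap_def exchange_def)
qed

text \<open>Indexing left jumps by their target puts both directions on the same edge. A jump
  requires a particle behind the jumping one; the particle beyond the hole is supplied by
  ergodicity, which makes the condition symmetric.\<close>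

lemma sfep_generator_edge_swap:
  assumes \<xi>: "\<xi> \<in> ergodic_component N k"
  shows "sfep_generator N f \<xi> = (\<Sum>y\<in>circle N. 1/2 * (f (edge_swap y \<xi>) - f \<xi>))"
proof -
  let ?r = "right_of N" and ?l = "left_of N"
  have N5: "int N > 4" using four_le_k k_less by simp
  have rc: "?r z \<in> circle N" for z using N5 by (simp add: right_of_def circle_def)
  have lc: "?l z \<in> circle N" for z using N5 by (simp add: left_of_def circle_def)
  have lr: "?l (?r z) = z" "?r (?l z) = z" if "z \<in> circle N" for z
    using that by (simp_all add: left_of_def right_of_def circle_def mod_simps)
  have shift: "(\<Sum>y\<in>circle N. g y) = (\<Sum>y\<in>circle N. g (?r y))" for g :: "int \<Rightarrow> real"
    by (rule sum.reindex_bij_witness[of _ ?r ?l]) (use rc lc lr in auto)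
  have ex: "exchange \<xi> (?r y) y = exchange \<xi> y (?r y)" for y
    by (auto simp: exchange_def)
  have *: "1/2 * real (\<xi> y) * real (\<xi> (?l y)) * (1 - real (\<xi> (?r y))) * (f (exchange \<xi> y (?r y)) - f \<xi>)
      + 1/2 * real (\<xi> (?r y)) * real (\<xi> (?r (?r y))) * (1 - real (\<xi> (?l (?r y))))
        * (f (exchange \<xi> (?r y) (?l (?r y))) - f \<xi>)
      = 1/2 * (f (edge_swap y \<xi>) - f \<xi>)" if y: "y \<in> circle N" for y
  proof -
    have nb: "\<xi> z = 1 \<or> \<xi> (?r z) = 1" if "z \<in> circle N" for z
      using \<xi> that ergodic_component_value[OF \<xi> that] ergodic_component_value[OF \<xi> rc[of z]]
      by (force simp: ergodic_component_def)
    show ?thesis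
      using nb[OF y] nb[OF lc[of y]] nb[OF rc[of y]] lr[OF y] ex[of y]
        ergodic_component_value[OF \<xi> y] ergodic_component_value[OF \<xi> rc[of y]]
        ergodic_component_value[OF \<xi> lc[of y]] ergodic_component_value[OF \<xi> rc[of "?r y"]]
      by (auto simp: edge_swap_def)
  qed
  show ?thesis
    unfolding sfep_generator_def
    apply (subst (2) shift)
    unfolding sum.distrib[symmetric] using * by (intro sum.cong refl) blast
qed

lemma finite_ergodic_component: "finite (ergodic_component N k)"
proof -
  have "finite (circle N \<rightarrow>\<^sub>E {0, 1::nat})" by (intro finite_PiE) (auto simp: circle_def)
  then show ?thesis by (rule finite_subset[rotated]) (auto simp: ergodic_component_def configs_def)
qed

text \<open>Each edge swap permutes the component, so its increments cancel in the sum.\<close>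

lemma sum_lazy_step:
  "(\<Sum>\<xi>\<in>ergodic_component N k. lazy_step f \<xi>) = (\<Sum>\<xi>\<in>ergodic_component N k. f \<xi>)"
proof -
  let ?G = "ergodic_component N k"
  have "(\<Sum>\<xi>\<in>?G. f (edge_swap y \<xi>)) = (\<Sum>\<xi>\<in>?G. f \<xi>)" if y: "y \<in> circle N" for y
    by (rule sum.reindex_bij_witness[of _ "edge_swap y" "edge_swap y"])
      (use edge_swap_ergodic_component[OF _ y] edge_swap_involution[OF y] in auto)
  then have z: "(\<Sum>\<xi>\<in>?G. 1/2 * (f (edge_swap y \<xi>) - f \<xi>)) = 0" if "y \<in> circle N" for y
    using that unfolding sum_distrib_left[symmetric] sum_subtractf by simp
  have "(\<Sum>\<xi>\<in>?G. sfep_generator N f \<xi>) = (\<Sum>\<xi>\<in>?G. \<Sum>y\<in>circle N. 1/2 * (f (edge_swap y \<xi>) - f \<xi>))"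
    using sfep_generator_edge_swap by (intro sum.cong) auto
  also have "\<dots> = (\<Sum>y\<in>circle N. \<Sum>\<xi>\<in>?G. 1/2 * (f (edge_swap y \<xi>) - f \<xi>))" by (rule sum.swap)
  also have "\<dots> = 0" using z by (intro sum.neutral) auto
  finally show ?thesis by (simp add: lazy_step_def sum.distrib sum_divide_distrib[symmetric])
qed

lemma sum_lazy_step_iterate:
  "(\<Sum>\<xi>\<in>ergodic_component N k. (lazy_step ^^ n) f \<xi>) = (\<Sum>\<xi>\<in>ergodic_component N k. f \<xi>)"
  by (induction n) (simp_all add: sum_lazy_step)

lemma ergodic_component_nonempty: "ergodic_component N k \<noteq> {}"
proof -
  \<comment> \<open>Holes are put at the odd sites 1, 3, ..., \<open>2 * (N - k) - 1\<close>, which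
    fit since \<open>2 * (N - k) < N\<close>. Across the wrap, site 0 is even and so
    occupied.\<close>
  let ?h = "int (N - k)"
  let ?\<xi> = "\<lambda>y\<in>circle N. if odd y \<and> y < 2 * ?h then 0 else 1 :: nat"
  let ?H = "{y \<in> circle N. odd y \<and> y < 2 * ?h}"
  have h: "2 * (N - k) < N" using k_less N_less by simp
  have fin: "finite (circle N)" by (simp add: circle_def)
  have "?H = (\<lambda>i. 2 * int i + 1) ` {..<N - k}"
  proof (intro set_eqI iffI)
    fix y assume "y \<in> ?H"
    then have y: "0 \<le> y" "odd y" "y < 2 * ?h" by (auto simp: circle_def)
    then obtain c where c: "y = 2 * c + 1" by (auto elim: oddE)
    then have "0 \<le> c" "c < ?h" using y by auto
    then have "nat c < N - k" "y = 2 * int (nat c) + 1" using c by (simp_all add: nat_less_iff)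
    then show "y \<in> (\<lambda>i. 2 * int i + 1) ` {..<N - k}" by blast
  next
    fix y assume "y \<in> (\<lambda>i. 2 * int i + 1) ` {..<N - k}"
    then show "y \<in> ?H" using h by (auto simp: circle_def)
  qed
  then have cH: "card ?H = N - k" by (simp add: card_image inj_on_def)
  have "(\<Sum>y\<in>circle N. ?\<xi> y) = (\<Sum>y\<in>circle N. if y \<in> circle N - ?H then 1 else 0)"
    by (intro sum.cong) auto
  also have "\<dots> = card (circle N - ?H)"
    using fin unfolding card_eq_sum by (intro sum.mono_neutral_cong_right) auto
  also have "\<dots> = card (circle N) - card ?H"
    by (intro card_Diff_subset finite_subset[OF _ fin]) auto
  also have "\<dots> = N - (N - k)" unfolding cH by (simp add: circle_def)
  finally have "(\<Sum>y\<in>circle N. ?\<xi> y) = k" using k_less by simp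
  moreover have "?\<xi> y + ?\<xi> (right_of N y) \<ge> 1" if y: "y \<in> circle N" for y
  proof -
    have "right_of N y \<in> circle N" using k_less by (simp add: right_of_def circle_def)
    moreover have "even y \<or> even (right_of N y)" using y by (auto simp: right_of_circle)
    ultimately show ?thesis using y by auto
  qed
  moreover have "?\<xi> \<in> circle N \<rightarrow>\<^sub>E {0, 1}" by auto
  ultimately have "?\<xi> \<in> ergodic_component N k" by (simp add: ergodic_component_def configs_def)
  then show ?thesis by blast
qed

text \<open>By invariance the uniform mass of \<open>S\<close> is the average of the iterate over
  the component, and a value is no further from the average than the oscillation.\<close>

lemma lazy_step_iterate_uniform:
  fixes \<theta> :: real
  assumes \<theta>: "0 < \<theta>" "\<theta> * k \<le> pi / 2" and h: "real (N - k) * sin \<theta> \<le> sin (\<theta> * k)"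
    and \<xi>: "\<xi> \<in> ergodic_component N k"
  shows "\<bar>(lazy_step ^^ n) (indicator S) \<xi> - ergodic_uniform N k S\<bar>
    \<le> 2 * real N * real k * (1 - 2 * (1 - cos \<theta>) / k) ^ n"
proof -
  let ?G = "ergodic_component N k" and ?g = "(lazy_step ^^ n) (indicator S)"
  let ?B = "2 * real N * real k * (1 - 2 * (1 - cos \<theta>) / k) ^ n"
  have c: "real (card ?G) > 0"
    using ergodic_component_nonempty finite_ergodic_component by (simp add: card_gt_0_iff)
  have "ergodic_uniform N k S = (\<Sum>\<eta>\<in>?G. indicator S \<eta>) / card ?G"
    unfolding ergodic_uniform_def
    unfolding measure_pmf_of_set[OF ergodic_component_nonempty finite_ergodic_component]
    using finite_ergodic_component by (simp add: indicator_def of_bool_def sum.If_cases)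
  also have "\<dots> = (\<Sum>\<eta>\<in>?G. ?g \<eta>) / card ?G" by (simp only: sum_lazy_step_iterate)
  finally have "?g \<xi> - ergodic_uniform N k S = (\<Sum>\<eta>\<in>?G. ?g \<xi> - ?g \<eta>) / card ?G"
    using c by (simp add: sum_subtractf field_simps)
  also have "\<bar>\<dots>\<bar> \<le> (\<Sum>\<eta>\<in>?G. ?B) / card ?G"
    unfolding abs_divide abs_of_nat
    by (intro divide_right_mono order_trans[OF sum_abs] sum_mono
        lazy_step_iterate_oscillation[OF \<theta> h \<xi>]) auto
  also have "\<dots> = ?B" using c by simp
  finally show ?thesis .
qed

section \<open>From the lazy chain to the semigroup\<close>

lemma sfep_generator_eq_lazy_step: "sfep_generator N f = (\<lambda>\<xi>. real k * (lazy_step f \<xi> - f \<xi>))"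
  using four_le_k by (auto simp: lazy_step_def)

lemma sfep_generator_diff_scale:
  "sfep_generator N (\<lambda>\<xi>. c * (f \<xi> - g \<xi>)) = (\<lambda>\<xi>. c * (sfep_generator N f \<xi> - sfep_generator N g \<xi>))"
  unfolding sfep_generator_def fun_eq_iff right_diff_distrib distrib_left sum_distrib_left
    add_diff_add sum_subtractf[symmetric]
  by (intro allI arg_cong2[of _ _ _ _ "(+)"] sum.cong refl) (simp_all add: algebra_simps)

lemma sfep_generator_iterate_diff_scale:
  "(sfep_generator N ^^ n) (\<lambda>\<xi>. c * (f \<xi> - g \<xi>))
    = (\<lambda>\<xi>. c * ((sfep_generator N ^^ n) f \<xi> - (sfep_generator N ^^ n) g \<xi>))"
  by (induction n) (simp_all add: sfep_generator_diff_scale)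

lemma sfep_generator_iterate_binomial:
  "(sfep_generator N ^^ n) f \<xi>
    = real k ^ n * (\<Sum>i\<le>n. real (n choose i) * (-1) ^ (n + i) * (lazy_step ^^ i) f \<xi>)"
proof -
  define u where "u n j = (sfep_generator N ^^ n) ((lazy_step ^^ j) f) \<xi>" for n j
  have "u (Suc n) j = real k * (u n (Suc j) - u n j)" for n j
  proof -
    have "u (Suc n) j = (sfep_generator N ^^ n) (sfep_generator N ((lazy_step ^^ j) f)) \<xi>"
      by (simp add: u_def funpow_swap1)
    also have "sfep_generator N ((lazy_step ^^ j) f)
        = (\<lambda>\<xi>. real k * ((lazy_step ^^ Suc j) f \<xi> - (lazy_step ^^ j) f \<xi>))"
      by (subst sfep_generator_eq_lazy_step) simp
    finally show ?thesis unfolding sfep_generator_iterate_diff_scale u_def .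
  qed
  from iterated_difference_binomial[of u, OF this, of n 0] show ?thesis by (simp add: u_def)
qed

lemma real_exp_sums: "(\<lambda>i. c ^ i / fact i) sums exp (c::real)"
  using exp_converges[of c] by (simp add: divide_inverse mult.commute)

text \<open>With \<open>P\<close> for \<open>lazy_step\<close> and \<open>L\<close> for the
  generator, this is \<open>exp (t L) = exp (- k t) exp (k t P)\<close>. The binomial form of
  \<open>L ^ n\<close> makes each term of the semigroup series a Cauchy product term of the two
  exponential series; \<open>M\<close> gives absolute convergence.\<close>

lemma sfep_semigroup_lazy_step:
  assumes "\<And>i. \<bar>(lazy_step ^^ i) f \<xi>\<bar> \<le> M"
  shows "(\<lambda>i. (real k * t) ^ i / fact i * (lazy_step ^^ i) f \<xi>) sums (exp (real k * t) * sfep_semigroup N t f \<xi>)"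
proof -
  let ?A = "\<lambda>i. (real k * t) ^ i / fact i * (lazy_step ^^ i) f \<xi>"
  let ?E = "\<lambda>i. (- (real k * t)) ^ i / fact i"
  have E: "?E sums exp (- (real k * t))" by (rule real_exp_sums)
  have nE: "summable (\<lambda>i. norm ((c::real) ^ i / fact i))" for c
    using summable_norm_exp[of c] by (simp add: divide_inverse mult.commute)
  have "summable (\<lambda>i. norm ((real k * t) ^ i / fact i) * M)"
    using nE by (rule summable_mult2)
  then have nA: "summable (\<lambda>i. norm (?A i))"
  proof (rule summable_comparison_test')
    show "norm (norm (?A i)) \<le> norm ((real k * t) ^ i / fact i) * M" if "i \<ge> 0" for i
      unfolding real_norm_def abs_idempotent abs_mult using assms[of i] by (rule mult_left_mono) simp
  qed
  have "t ^ n / fact n * (sfep_generator N ^^ n) f \<xi> = (\<Sum>i\<le>n. ?A i * ?E (n - i))" for n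
  proof -
    have "t ^ n / fact n * (sfep_generator N ^^ n) f \<xi>
      = (\<Sum>i\<le>n. t ^ n / fact n * (real k ^ n * (real (n choose i) * (-1) ^ (n + i) * (lazy_step ^^ i) f \<xi>)))"
      unfolding sfep_generator_iterate_binomial sum_distrib_left by (rule refl)
    also have "\<dots> = (\<Sum>i\<le>n. ?A i * ?E (n - i))"
    proof (rule sum.cong[OF refl])
      fix i assume "i \<in> {..n}"
      then have i: "i \<le> n" by simp
      have sgn: "(- (real k * t)) ^ (n - i) = (-1) ^ (n + i) * (real k * t) ^ (n - i)"
        using i by (subst power_minus) (simp add: minus_one_power_iff)
      have "(real k * t) ^ n = (real k * t) ^ i * (real k * t) ^ (n - i)"
        using i by (simp add: power_add[symmetric])
      then have pw: "real k ^ n * t ^ n = (real k * t) ^ i * (real k * t) ^ (n - i)"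
        by (simp only: power_mult_distrib)
      have bin: "real (n choose i) = fact n / (fact i * fact (n - i))"
        using i by (rule binomial_fact)
      show "t ^ n / fact n * (real k ^ n * (real (n choose i) * (-1) ^ (n + i) * (lazy_step ^^ i) f \<xi>))
          = ?A i * ?E (n - i)"
        (is "_ / _ * (_ * (_ * ?s * ?q)) = _")
      proof -
        have "t ^ n / fact n * (real k ^ n * (real (n choose i) * ?s * ?q))
            = real k ^ n * t ^ n * (real (n choose i) / fact n) * (?s * ?q)" by simp
        also have "\<dots> = (real k * t) ^ i * (real k * t) ^ (n - i) * (1 / (fact i * fact (n - i))) * (?s * ?q)"
          unfolding pw bin by simp
        also have "\<dots> = ?A i * ?E (n - i)" unfolding sgn by simp
        finally show ?thesis .
      qed
    qed
    finally show ?thesis .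
  qed
  then have "sfep_semigroup N t f \<xi> = (\<Sum>n. \<Sum>i\<le>n. ?A i * ?E (n - i))"
    by (simp add: sfep_semigroup_def)
  also have "\<dots> = (\<Sum>i. ?A i) * (\<Sum>i. ?E i)"
    using Cauchy_product[OF nA nE] by simp
  also have "(\<Sum>i. ?E i) = exp (- (real k * t))" using E by (simp add: sums_iff)
  finally have "exp (real k * t) * sfep_semigroup N t f \<xi> = (\<Sum>i. ?A i)"
    by (simp add: exp_minus field_simps)
  then show ?thesis using summable_norm_cancel[OF nA] by (simp add: sums_iff)
qed

text \<open>Averaging geometric decay of ratio \<open>r\<close> over a Poisson number of steps of
  mean \<open>k * t\<close> gives \<open>exp (- k * t * (1 - r))\<close>, where
  \<open>k * (1 - r) = 2 * (1 - cos \<theta>)\<close>.\<close>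

lemma sfep_law_uniform:
  fixes \<theta> t :: real
  assumes \<theta>: "0 < \<theta>" "\<theta> * k \<le> pi / 2" and h: "real (N - k) * sin \<theta> \<le> sin (\<theta> * k)"
    and \<xi>: "\<xi> \<in> ergodic_component N k" and t: "t \<ge> 0"
  shows "\<bar>sfep_law N t \<xi> S - ergodic_uniform N k S\<bar>
    \<le> 2 * real N * real k * exp (- (2 * (1 - cos \<theta>) * t))"
proof -
  let ?M = "2 * real N * real k" and ?r = "1 - 2 * (1 - cos \<theta>) / k"
  let ?u = "ergodic_uniform N k S"
  let ?q = "\<lambda>i. (lazy_step ^^ i) (indicator S) \<xi>"
  note dev = lazy_step_iterate_uniform[OF \<theta> h \<xi>, of _ S]
  have k4: "real k \<ge> 4" using four_le_k by simp
  have "2 * (1 - cos \<theta>) \<le> 4"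
    unfolding right_diff_distrib using cos_ge_minus_one[of \<theta>] by linarith
  then have "?r \<ge> 0" using k4 by simp
  moreover have "?r \<le> 1" using k4 by simp
  ultimately have "?r ^ i \<le> 1" for i by (rule power_le_one)
  then have "?M * ?r ^ i \<le> ?M * 1" for i by (intro mult_left_mono) auto
  then have "\<bar>?q i\<bar> \<le> ?M + \<bar>?u\<bar>" for i using dev[of i] by (smt (verit))
  from sfep_semigroup_lazy_step[OF this, of t]
  have 1: "(\<lambda>i. (real k * t) ^ i / fact i * ?q i) sums (exp (real k * t) * sfep_law N t \<xi> S)"
    unfolding sfep_law_def .
  have 2: "(\<lambda>i. (real k * t) ^ i / fact i * ?q i - (real k * t) ^ i / fact i * ?u)
      sums (exp (real k * t) * sfep_law N t \<xi> S - exp (real k * t) * ?u)"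
    using 1 sums_mult2[OF real_exp_sums] by (rule sums_diff)
  have 3: "(\<lambda>i. ?M * ((real k * t * ?r) ^ i / fact i)) sums (?M * exp (real k * t * ?r))"
    using real_exp_sums by (rule sums_mult)
  have le: "norm ((real k * t) ^ i / fact i * ?q i - (real k * t) ^ i / fact i * ?u)
      \<le> ?M * ((real k * t * ?r) ^ i / fact i)" for i
  proof -
    have "norm ((real k * t) ^ i / fact i * ?q i - (real k * t) ^ i / fact i * ?u)
        = (real k * t) ^ i / fact i * \<bar>?q i - ?u\<bar>"
      using t unfolding right_diff_distrib[symmetric] by (simp add: abs_mult)
    also have "\<dots> \<le> (real k * t) ^ i / fact i * (?M * ?r ^ i)"
      using t dev[of i] by (intro mult_left_mono) auto
    also have "\<dots> = ?M * ((real k * t * ?r) ^ i / fact i)"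
      unfolding power_mult_distrib[of "real k * t"] by simp
    finally show ?thesis .
  qed
  have "norm (exp (real k * t) * sfep_law N t \<xi> S - exp (real k * t) * ?u) \<le> ?M * exp (real k * t * ?r)"
    using norm_suminf_le[OF le sums_summable[OF 3]]
    unfolding sums_unique[OF 2, symmetric] sums_unique[OF 3, symmetric] .
  then have "exp (real k * t) * \<bar>sfep_law N t \<xi> S - ?u\<bar> \<le> ?M * exp (real k * t * ?r)"
    unfolding right_diff_distrib[symmetric] by (simp add: abs_mult)
  also have "real k * t * ?r = real k * t + - (2 * (1 - cos \<theta>) * t)"
    using k4 by (simp add: field_simps)
  finally show ?thesis unfolding exp_add by (simp add: mult_ac)
qed

lemma ergodic_mixing_time_le:
  fixes \<theta> t :: real
  assumes \<theta>: "0 < \<theta>" "\<theta> * k \<le> pi / 2" and h: "real (N - k) * sin \<theta> \<le> sin (\<theta> * k)"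
    and t: "t \<ge> 0" and \<epsilon>: "2 * real N * real k * exp (- (2 * (1 - cos \<theta>) * t)) \<le> \<epsilon>"
  shows "ergodic_mixing_time N k \<epsilon> \<le> ereal t"
proof -
  have "tv_dist (configs N k) (sfep_law N t \<xi>) (ergodic_uniform N k) \<le> \<epsilon>"
    if "\<xi> \<in> ergodic_component N k" for \<xi>
    unfolding tv_dist_def using order_trans[OF sfep_law_uniform[OF \<theta> h that t] \<epsilon>]
    by (intro cSUP_least) auto
  then have "(MAX \<xi>\<in>ergodic_component N k.
      tv_dist (configs N k) (sfep_law N t \<xi>) (ergodic_uniform N k)) \<le> \<epsilon>"
    using finite_ergodic_component ergodic_component_nonempty by (subst Max_le_iff) auto
  then show ?thesis unfolding ergodic_mixing_time_def using t by (intro Inf_lower) auto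
qed

end

section \<open>Trigonometric estimates and choice of parameters\<close>

lemma sin_ge_cubic:
  fixes x :: real
  assumes "0 \<le> x"
  shows "x - x ^ 3 / 6 \<le> sin x"
proof -
  have "(\<Sum>m<3. sin_coeff m * x ^ m) = x" by (simp add: eval_nat_numeral sin_coeff_def)
  then have "\<bar>sin x - x\<bar> \<le> x ^ 3 / 6"
    using Maclaurin_sin_bound[of x 3] assms by (simp add: fact_numeral)
  then show ?thesis by linarith
qed

text \<open>Follows from \<open>1 - cos x = 2 * (sin (x / 2))\<^sup>2\<close> and
  \<open>sin (x / 2) \<ge> x / 4\<close>.\<close>

lemma one_minus_cos_ge:
  fixes x :: real
  assumes "0 \<le> x" "x \<le> 1"
  shows "x\<^sup>2 / 8 \<le> 1 - cos x"
proof -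
  have "x ^ 3 \<le> x" using power_decreasing[of 1 3 x] assms by simp
  moreover have "(x / 2) ^ 3 = x ^ 3 / 8" by (simp add: power_divide)
  ultimately have "x / 4 \<le> sin (x / 2)" using sin_ge_cubic[of "x / 2"] assms by linarith
  then have "(x / 4)\<^sup>2 \<le> (sin (x / 2))\<^sup>2" using assms by (intro power_mono) auto
  moreover have "cos x = 1 - 2 * (sin (x / 2))\<^sup>2" using cos_double_sin[of "x / 2"] by simp
  ultimately show ?thesis by (simp add: power_divide)
qed

theorem mainTheorem5:
  fixes k :: "nat \<Rightarrow> nat" and \<rho> :: real
  assumes "\<And>N. N \<ge> 1 \<Longrightarrow> real (k N) > real N / 2"
    and "(\<lambda>N. real (k N) / real N) \<longlonglongrightarrow> \<rho>"
    and "1/2 < \<rho>" and "\<rho> < 1"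
  shows "\<forall>\<epsilon>::real. 0 < \<epsilon> \<and> \<epsilon> < 1 \<longrightarrow>
    (\<exists>C::real. C > 0 \<and>
      (\<forall>\<^sub>F N in sequentially.
         ergodic_mixing_time N (k N) \<epsilon> \<le> ereal (C * (real N)\<^sup>2 * ln (real N))))"
proof (intro allI impI)
  fix \<epsilon> :: real assume \<epsilon>: "0 < \<epsilon> \<and> \<epsilon> < 1"
  \<comment> \<open>The ratio \<open>(N - k) / k\<close> tends to
    \<open>(1 - \<rho>) / \<rho>\<close>, which lies below \<open>1 / (2 * \<rho>)\<close> because
    \<open>\<rho> > 1/2\<close>; the same condition gives \<open>r < 1\<close>.\<close>
  define r where "r = 1 / (2 * \<rho>)"
  \<comment> \<open>The cubic bound gives \<open>sin a \<ge> r * a\<close> as soon as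
    \<open>a\<^sup>2 \<le> 6 * (1 - r)\<close>.\<close>
  define a where "a = sqrt (1 - r)"
  have r: "0 < r" "r < 1" using assms(3) by (simp_all add: r_def field_simps)
  have a: "0 < a" "a \<le> 1" "a\<^sup>2 = 1 - r" using r by (simp_all add: a_def)
  have "r * a \<le> a - a ^ 3 / 6"
  proof -
    have "a ^ 3 = (1 - r) * a" unfolding a(3)[symmetric] by (simp add: eval_nat_numeral)
    then have "a - a ^ 3 / 6 - r * a = 5 / 6 * ((1 - r) * a)" by (simp add: field_simps)
    moreover have "(1 - r) * a \<ge> 0" using r a by simp
    ultimately show ?thesis by linarith
  qed
  then have sin_a: "r * a \<le> sin a" using sin_ge_cubic[of a] a by linarith
  \<comment> \<open>With \<open>\<theta> \<ge> a / N\<close> and a decay rate of at least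
    \<open>\<theta>\<^sup>2 / 4\<close>, the exponent reaches \<open>3 * ln N\<close>, which beats
    the prefactor \<open>2 * N * k\<close> and leaves \<open>2 / N\<close>;
    \<open>\<epsilon>\<close> only enters the threshold for \<open>N\<close>.\<close>
  define C where "C = 12 / a\<^sup>2"
  have C: "C > 0" using a(1) by (simp add: C_def)
  \<comment> \<open>The inequality \<open>k / N > 1 / (1 + r)\<close> is a rearrangement of
    \<open>N - k < r * k\<close>.\<close>
  have "1 / (1 + r) < \<rho>" using assms(3) by (simp add: r_def field_simps)
  then have e1: "\<forall>\<^sub>F N in sequentially. 1 / (1 + r) < real (k N) / real N"
    by (rule order_tendstoD(1)[OF assms(2)])
  have e2: "\<forall>\<^sub>F N in sequentially. real (k N) / real N < 1"
    by (rule order_tendstoD(2)[OF assms(2,4)])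
  have "\<forall>\<^sub>F N in sequentially. ergodic_mixing_time N (k N) \<epsilon> \<le> ereal (C * (real N)\<^sup>2 * ln (real N))"
    using e1 e2 eventually_ge_at_top[of 8] eventually_ge_at_top[of "nat \<lceil>2 / \<epsilon>\<rceil>"]
  proof eventually_elim
    case (elim N)
    let ?\<theta> = "a / real (k N)" and ?t = "C * (real N)\<^sup>2 * ln (real N)"
    have N: "real N \<ge> 8" using elim(3) by simp
    have k: "real (k N) > real N / 2" using assms(1)[of N] elim(3) by simp
    have kN: "real (k N) < real N" using elim(2) N by (simp add: field_simps)
    interpret dense_ring N "k N"
    proof
      show "4 \<le> k N" "k N < N" "N < 2 * k N" using N k kN by linarith+
    qed
    have \<theta>: "0 < ?\<theta>" "?\<theta> * real (k N) = a" "?\<theta> \<le> 1" using a N k by (simp_all add: field_simps)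
    \<comment> \<open>The condition at \<open>d = k\<close> follows from \<open>(N - k) * sin
      \<theta> \<le> (N - k) * \<theta> \<le> r * a \<le> sin a\<close>, as
      \<open>\<theta> * k = a\<close>.\<close>
    have "real (N - k N) \<le> r * real (k N)"
      using elim(1) N kN r by (simp add: of_nat_diff field_simps)
    then have "real (N - k N) * ?\<theta> \<le> r * real (k N) * ?\<theta>"
      using \<theta> by (intro mult_right_mono) auto
    also have "\<dots> = r * (?\<theta> * real (k N))" by (simp only: mult_ac)
    also have "\<dots> = r * a" unfolding \<theta>(2) ..
    also have "\<dots> \<le> sin a" by (rule sin_a)
    finally have "real (N - k N) * ?\<theta> \<le> sin a" .
    moreover have "real (N - k N) * sin ?\<theta> \<le> real (N - k N) * ?\<theta>"
      using \<theta> by (intro mult_left_mono sin_x_le_x) auto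
    ultimately have h: "real (N - k N) * sin ?\<theta> \<le> sin (?\<theta> * real (k N))" unfolding \<theta>(2) by linarith
    have pi: "?\<theta> * real (k N) \<le> pi / 2" unfolding \<theta>(2) using a pi_gt3 by linarith
    have ln: "ln (real N) \<ge> 0" using N by simp
    then have t: "?t \<ge> 0" using C by simp
    have "3 * ln (real N) = (a / real N)\<^sup>2 / 4 * ?t" using a(1) N by (simp add: C_def field_simps)
    also have "\<dots> \<le> ?\<theta>\<^sup>2 / 4 * ?t"
      using t a kN k N by (intro mult_right_mono divide_right_mono power_mono divide_left_mono) auto
    also have "\<dots> \<le> 2 * (1 - cos ?\<theta>) * ?t"
      using one_minus_cos_ge[of ?\<theta>] \<theta> t by (intro mult_right_mono) auto
    finally have "exp (- (2 * (1 - cos ?\<theta>) * ?t)) \<le> exp (- (3 * ln (real N)))" by simp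
    also have "\<dots> = 1 / real N ^ 3" using N by (simp add: exp_minus exp_of_nat_mult[of 3, simplified] divide_inverse)
    finally have "2 * real N * real (k N) * exp (- (2 * (1 - cos ?\<theta>) * ?t))
        \<le> 2 * real N * real N * (1 / real N ^ 3)"
      using kN by (intro mult_mono) auto
    also have "\<dots> = 2 / real N" using N by (simp add: eval_nat_numeral field_simps)
    also have "\<dots> \<le> \<epsilon>"
    proof -
      have "2 / \<epsilon> \<le> real N" using elim(4) by linarith
      then show ?thesis using \<epsilon> N by (simp add: field_simps)
    qed
    finally show ?case by (rule ergodic_mixing_time_le[OF \<theta>(1) pi h t])
  qed
  then show "\<exists>C::real. C > 0 \<and> (\<forall>\<^sub>F N in sequentially.
      ergodic_mixing_time N (k N) \<epsilon> \<le> ereal (C * (real N)\<^sup>2 * ln (real N)))"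
    using C by blast
qed

end
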